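(* Let $n\ge1$, let $\Sigma(n)$ be a homotopy $n$-sphere, and let $G$ be a discrete group acting freely and properly discontinuously on $\Sigma(n)$. Then the quotient map $\Sigma(n)\to\Sigma(n)/G$ induces an isomorphism of groups $$[\Omega(\mathbb{S}^{r+1}),\Omega(\Sigma(n))]\stackrel{\cong}{\longrightarrow}[\Omega(\mathbb{S}^{r+1}),\Omega(\Sigma(n)/G)]$$ for $r\ge 1$. In particular, the quotient map $\gamma_{n,\mathbb{R}}:\mathbb{S}^n\to\mathbb{R}P^n$ onto the $n$-th real projective space induces an isomorphism $$[\Omega(\mathbb{S}^{r+1}),\Omega(\mathbb{S}^n)]\stackrel{\cong}{\longrightarrow}[\Omega(\mathbb{S}^{r+1}),\Omega(\mathbb{R}P^n)]$$ for $r\ge1$. Consequently, $$\exp_p([\Omega(\mathbb{S}^{r+1}),\Omega(\Sigma(n)/G)])=\exp_p([\Omega(\mathbb{S}^{r+1}),\Omega(\Sigma(n))])$$ and $$\exp_p([\Omega(\mathbb{S}^{r+1}),\Omega(\mathbb{R}P^n)])=\exp_p([\Omega(\mathbb{S}^{r+1}),\Omega(\mathbb{S}^n)])$$ for $n,r\ge1$ and for any prime $p$.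
   Context: A homotopy $n$-sphere $\Sigma(n)$ is a finite-dimensional CW-complex with the homotopy type of the $n$-sphere $\mathbb{S}^n$. $[X,Y]$ denotes the set of pointed homotopy classes of pointed maps $X\to Y$; $[\Omega(\mathbb{S}^{r+1}),\Omega(Y)]$ is a group under the multiplication induced by loop multiplication in $\Omega(Y)$. For a group $H$, $\exp_p(H)$ is the least integer $p^t$ such that $\alpha^{p^t}=1$ for every $p$-torsion element $\alpha\in H$ (element of order a power of $p$); if no such integer exists or $H$ has no $p$-torsion, $\exp_p(H)=1$. *)

theory Defs
  imports "HOL-Analysis.Analysis" "HOL-Algebra.Group_Action" "HOL-Algebra.Multiplicative_Group"
begin

section \<open>Finite-dimensional CW-complexes and homotopy spheres\<close>

definition closed_disk :: "nat \<Rightarrow> (nat \<Rightarrow> real) set" where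
  "closed_disk k = {x \<in> topspace (Euclidean_space k). (\<Sum>i<k. (x i)\<^sup>2) \<le> 1}"

definition open_disk :: "nat \<Rightarrow> (nat \<Rightarrow> real) set" where
  "open_disk k = {x \<in> topspace (Euclidean_space k). (\<Sum>i<k. (x i)\<^sup>2) < 1}"

text \<open>
  A CW structure on \<open>X\<close> in the sense of Whitehead. The cells are indexed by the open cells
  themselves, i.e. by the members of a partition \<open>E\<close> of the underlying set; \<open>d e\<close> is the
  dimension of \<open>e\<close> and \<open>\<Phi> e\<close> its characteristic map.
\<close>

definition cw_structure ::
  "'a topology \<Rightarrow> 'a set set \<Rightarrow> ('a set \<Rightarrow> nat) \<Rightarrow> ('a set \<Rightarrow> (nat \<Rightarrow> real) \<Rightarrow> 'a) \<Rightarrow> bool"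
where
  "cw_structure X E d \<Phi> \<longleftrightarrow>
     Hausdorff_space X \<and>
     partition_on (topspace X) E \<and>
     (\<forall>e\<in>E.
        continuous_map (subtopology (Euclidean_space (d e)) (closed_disk (d e))) X (\<Phi> e) \<and>
        homeomorphic_map (subtopology (Euclidean_space (d e)) (open_disk (d e)))
                         (subtopology X e) (\<Phi> e) \<and>
        (\<exists>F\<subseteq>E. finite F \<and> (\<forall>e'\<in>F. d e' < d e) \<and>
               \<Phi> e ` (closed_disk (d e) - open_disk (d e)) \<subseteq> \<Union>F)) \<and>
     (\<forall>A\<subseteq>topspace X. (\<forall>e\<in>E. closedin X (A \<inter> X closure_of e)) \<longrightarrow> closedin X A)"

definition finite_dim_cw_complex :: "'a topology \<Rightarrow> bool" where
  "finite_dim_cw_complex X \<longleftrightarrow>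
     (\<exists>E d \<Phi> N. cw_structure X E d \<Phi> \<and> (\<forall>e\<in>E. d e \<le> N))"

definition homotopy_sphere :: "nat \<Rightarrow> 'a topology \<Rightarrow> bool" where
  "homotopy_sphere n X \<longleftrightarrow>
     finite_dim_cw_complex X \<and> X homotopy_equivalent_space nsphere n"


section \<open>Quotient spaces, group actions, real projective space\<close>

definition quotient_topology :: "'a topology \<Rightarrow> ('a \<Rightarrow> 'b) \<Rightarrow> 'b topology" where
  "quotient_topology X q =
     topology (\<lambda>U. U \<subseteq> q ` topspace X \<and> openin X {x \<in> topspace X. q x \<in> U})"

lemma openin_quotient_topology:
  "openin (quotient_topology X q) U \<longleftrightarrow>
     U \<subseteq> q ` topspace X \<and> openin X {x \<in> topspace X. q x \<in> U}"
proof -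
  have "istopology (\<lambda>U. U \<subseteq> q ` topspace X \<and> openin X {x \<in> topspace X. q x \<in> U})"
    unfolding istopology_def
  proof (intro conjI allI impI)
    fix S T assume "S \<subseteq> q ` topspace X \<and> openin X {x \<in> topspace X. q x \<in> S}"
      and "T \<subseteq> q ` topspace X \<and> openin X {x \<in> topspace X. q x \<in> T}"
    moreover have "{x \<in> topspace X. q x \<in> S \<inter> T} =
        {x \<in> topspace X. q x \<in> S} \<inter> {x \<in> topspace X. q x \<in> T}" by auto
    ultimately show "S \<inter> T \<subseteq> q ` topspace X" "openin X {x \<in> topspace X. q x \<in> S \<inter> T}"
      by auto
  next
    fix \<K> assume *: "\<forall>K\<in>\<K>. K \<subseteq> q ` topspace X \<and> openin X {x \<in> topspace X. q x \<in> K}"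
    then show "\<Union>\<K> \<subseteq> q ` topspace X" by auto
    have "{x \<in> topspace X. q x \<in> \<Union>\<K>} = (\<Union>K\<in>\<K>. {x \<in> topspace X. q x \<in> K})" by auto
    with * show "openin X {x \<in> topspace X. q x \<in> \<Union>\<K>}" by auto
  qed
  then show ?thesis
    by (simp add: quotient_topology_def topology_inverse')
qed

lemma topspace_quotient_topology [simp]: "topspace (quotient_topology X q) = q ` topspace X"
proof
  show "topspace (quotient_topology X q) \<subseteq> q ` topspace X"
    using openin_quotient_topology[of X q "topspace (quotient_topology X q)"] by simp
  have "{x \<in> topspace X. q x \<in> q ` topspace X} = topspace X" by auto
  then have "openin (quotient_topology X q) (q ` topspace X)"
    by (simp add: openin_quotient_topology)
  then show "q ` topspace X \<subseteq> topspace (quotient_topology X q)"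
    by (rule openin_subset)
qed

lemma quotient_map_quotient_topology: "quotient_map X (quotient_topology X q) q"
  by (auto simp: quotient_map_def openin_quotient_topology)

text \<open>
  Freeness is stated separately, so proper discontinuity is the local finiteness condition.
  On a Hausdorff space the two together are equivalent to every point having a neighbourhood
  that is disjoint from all of its translates by \<open>g \<noteq> \<one>\<close>.
\<close>

definition free_properly_discontinuous_action ::
  "('g, 'm) monoid_scheme \<Rightarrow> 'a topology \<Rightarrow> ('g \<Rightarrow> 'a \<Rightarrow> 'a) \<Rightarrow> bool"
where
  "free_properly_discontinuous_action G X \<phi> \<longleftrightarrow>
     group_action G (topspace X) \<phi> \<and>
     (\<forall>g\<in>carrier G. homeomorphic_map X X (\<phi> g)) \<and>
     (\<forall>x\<in>topspace X. stabilizer G \<phi> x = {\<one>\<^bsub>G\<^esub>}) \<and>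
     (\<forall>x\<in>topspace X. \<exists>U. openin X U \<and> x \<in> U \<and> finite {g \<in> carrier G. \<phi> g ` U \<inter> U \<noteq> {}})"

definition orbit_space ::
  "('g, 'm) monoid_scheme \<Rightarrow> 'a topology \<Rightarrow> ('g \<Rightarrow> 'a \<Rightarrow> 'a) \<Rightarrow> 'a set topology"
where
  "orbit_space G X \<phi> = quotient_topology X (orbit G \<phi>)"

definition antipodal_class :: "(nat \<Rightarrow> real) \<Rightarrow> (nat \<Rightarrow> real) set" where
  "antipodal_class x = {x, (\<lambda>i. - x i)}"

definition real_projective_space :: "nat \<Rightarrow> (nat \<Rightarrow> real) set topology" where
  "real_projective_space n = quotient_topology (nsphere n) antipodal_class"


section \<open>Loop spaces\<close>

text \<open>Maps are taken extensional, so that each continuous map is represented exactly once.\<close>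

definition compact_open_topology :: "'a topology \<Rightarrow> 'b topology \<Rightarrow> ('a \<Rightarrow> 'b) topology" where
  "compact_open_topology X Y =
     topology_generated_by
       {{f \<in> extensional (topspace X). continuous_map X Y f \<and> f ` K \<subseteq> U} | K U.
          compactin X K \<and> openin Y U}"

definition loop_space :: "'a topology \<Rightarrow> 'a \<Rightarrow> (real \<Rightarrow> 'a) topology" where
  "loop_space X x0 =
     subtopology (compact_open_topology (top_of_set {0..1}) X) {l. l 0 = x0 \<and> l 1 = x0}"

definition const_loop :: "'a \<Rightarrow> real \<Rightarrow> 'a" where
  "const_loop x0 = restrict (\<lambda>_. x0) {0..1}"

text \<open>The library's path concatenation requires a type of class \<^class>\<open>topological_space\<close>.\<close>

definition loop_mult :: "(real \<Rightarrow> 'a) \<Rightarrow> (real \<Rightarrow> 'a) \<Rightarrow> real \<Rightarrow> 'a" where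
  "loop_mult l m = restrict (\<lambda>t. if t \<le> 1/2 then l (2 * t) else m (2 * t - 1)) {0..1}"

definition loop_map :: "('a \<Rightarrow> 'b) \<Rightarrow> (real \<Rightarrow> 'a) \<Rightarrow> real \<Rightarrow> 'b" where
  "loop_map q l = restrict (q \<circ> l) {0..1}"


section \<open>Pointed homotopy classes and the groups of maps into loop spaces\<close>

definition pointed_maps :: "'a topology \<Rightarrow> 'a \<Rightarrow> 'b topology \<Rightarrow> 'b \<Rightarrow> ('a \<Rightarrow> 'b) set" where
  "pointed_maps A a Y y = {f. continuous_map A Y f \<and> f a = y}"

definition pointed_class ::
  "'a topology \<Rightarrow> 'a \<Rightarrow> 'b topology \<Rightarrow> 'b \<Rightarrow> ('a \<Rightarrow> 'b) \<Rightarrow> ('a \<Rightarrow> 'b) set"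
where
  "pointed_class A a Y y f = {g. homotopic_with (\<lambda>h. h a = y) A Y f g}"

definition pointed_homotopy_classes ::
  "'a topology \<Rightarrow> 'a \<Rightarrow> 'b topology \<Rightarrow> 'b \<Rightarrow> ('a \<Rightarrow> 'b) set set"
where
  "pointed_homotopy_classes A a Y y = pointed_class A a Y y ` pointed_maps A a Y y"

text \<open>
  The group \<open>[A, \<Omega>(Y)]\<close>. The product and the induced map below are given on classes by
  representatives: each union is over the (equal) classes obtained from all representatives.
\<close>

definition maps_to_loops_group ::
  "'a topology \<Rightarrow> 'a \<Rightarrow> 'b topology \<Rightarrow> 'b \<Rightarrow> ('a \<Rightarrow> real \<Rightarrow> 'b) set monoid"
where
  "maps_to_loops_group A a Y y =
     \<lparr>carrier = pointed_homotopy_classes A a (loop_space Y y) (const_loop y),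
      mult = (\<lambda>c d. \<Union>f\<in>c. \<Union>g\<in>d.
                pointed_class A a (loop_space Y y) (const_loop y) (\<lambda>x. loop_mult (f x) (g x))),
      one = pointed_class A a (loop_space Y y) (const_loop y) (\<lambda>_. const_loop y)\<rparr>"

text \<open>The group \<open>[\<Omega>(\<S>\<^sup>k), \<Omega>(Y)]\<close>.\<close>

definition loops_sphere_group ::
  "nat \<Rightarrow> (nat \<Rightarrow> real) \<Rightarrow> 'b topology \<Rightarrow> 'b \<Rightarrow> ((real \<Rightarrow> nat \<Rightarrow> real) \<Rightarrow> real \<Rightarrow> 'b) set monoid"
where
  "loops_sphere_group k s Y y = maps_to_loops_group (loop_space (nsphere k) s) (const_loop s) Y y"

text \<open>The map \<open>[A, \<Omega>(X)] \<rightarrow> [A, \<Omega>(Y)]\<close> induced by \<open>q : X \<rightarrow> Y\<close>, where \<open>y = q x\<close>.\<close>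

definition induced_map ::
  "'a topology \<Rightarrow> 'a \<Rightarrow> 'c topology \<Rightarrow> 'c \<Rightarrow> ('b \<Rightarrow> 'c) \<Rightarrow>
   ('a \<Rightarrow> real \<Rightarrow> 'b) set \<Rightarrow> ('a \<Rightarrow> real \<Rightarrow> 'c) set"
where
  "induced_map A a Y y q c =
     (\<Union>f\<in>c. pointed_class A a (loop_space Y y) (const_loop y) (\<lambda>x. loop_map q (f x)))"

definition loops_sphere_induced ::
  "nat \<Rightarrow> (nat \<Rightarrow> real) \<Rightarrow> 'c topology \<Rightarrow> 'c \<Rightarrow> ('b \<Rightarrow> 'c) \<Rightarrow>
   ((real \<Rightarrow> nat \<Rightarrow> real) \<Rightarrow> real \<Rightarrow> 'b) set \<Rightarrow> ((real \<Rightarrow> nat \<Rightarrow> real) \<Rightarrow> real \<Rightarrow> 'c) set"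
where
  "loops_sphere_induced k s = induced_map (loop_space (nsphere k) s) (const_loop s)"

definition group_isomorphism ::
  "('a, 'm) monoid_scheme \<Rightarrow> ('b, 'k) monoid_scheme \<Rightarrow> ('a \<Rightarrow> 'b) \<Rightarrow> bool"
where
  "group_isomorphism H K h \<longleftrightarrow> group H \<and> group K \<and> h \<in> iso H K"


section \<open>The \<open>p\<close>-exponent of a group\<close>

definition p_torsion_elements :: "nat \<Rightarrow> ('a, 'm) monoid_scheme \<Rightarrow> 'a set" where
  "p_torsion_elements p H = {a \<in> carrier H. \<exists>k. group.ord H a = p ^ k}"

text \<open>
  The identity has order \<open>p ^ 0\<close>; if it is the only \<open>p\<close>-torsion element, the least value is \<open>1\<close>.
\<close>

definition exp_p :: "nat \<Rightarrow> ('a, 'm) monoid_scheme \<Rightarrow> nat" where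
  "exp_p p H =
     (let P = (\<lambda>m. (\<exists>t. m = p ^ t) \<and> (\<forall>a\<in>p_torsion_elements p H. a [^]\<^bsub>H\<^esub> m = \<one>\<^bsub>H\<^esub>))
      in if \<exists>m. P m then (LEAST m. P m) else 1)"

end

theory Submission
  imports Defs
begin

text \<open>
  The reason is a general one: if \<open>q : X \<rightarrow> Y\<close> is a covering map, then \<open>\<Omega>(q) : \<Omega>(X) \<rightarrow> \<Omega>(Y)\<close> induces
  an isomorphism \<open>[A, \<Omega>(X)] \<rightarrow> [A, \<Omega>(Y)]\<close> for every connected space \<open>A\<close>.

  By the exponential law a pointed map \<open>A \<rightarrow> \<Omega>(Y)\<close> is a homotopy \<open>A \<times> [0,1] \<rightarrow> Y\<close> that is constant
  with value \<open>q x\<close> at both ends. The homotopy lifting property holds for an arbitrary parameter space,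
  so this homotopy lifts to \<open>X\<close>, starting from the constant map \<open>x\<close>. Its end is a lift of a constant
  map on the connected space \<open>A\<close> and has the value \<open>x\<close> at the base point, hence is constant \<open>x\<close>: the
  lifted paths are loops (lemma \<open>covering_lift_into_loop_space\<close>). This gives surjectivity, and the
  same lemma applied to \<open>[0,1] \<times> A\<close> gives injectivity (\<open>covering_induces_iso\<close>).

  Two geometric facts connect this with the theorem. The orbit map of a free, properly discontinuous
  action on a Hausdorff space, such as a CW-complex, is a covering map (\<open>covering_map_orbit\<close>), and
  the projection onto real projective space is the orbit map of the antipodal action. The space \<open>A = \<Omega>(\<S>\<^sup>r\<^sup>+\<^sup>1)\<close> is connected
  for \<open>r \<ge> 1\<close>, because every loop in a sphere of dimension at least two is null-homotopic
  (\<open>loop_nsphere_null_homotopic\<close>): by a measure argument it can be pushed off the point antipodal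
  to the base point.

  The equality of \<open>p\<close>-exponents is then formal, since an isomorphism preserves powers and orders.
\<close>

section \<open>Continuous families of loops\<close>

abbreviation unit_interval :: "real topology" where
  "unit_interval \<equiv> top_of_set {0..1}"

lemma topspace_loop_space:
  "topspace (loop_space Y y) =
     {l \<in> extensional {0..1}. continuous_map unit_interval Y l \<and> l 0 = y \<and> l 1 = y}"
proof -
  have "\<Union>{{f \<in> extensional {0..1}. continuous_map unit_interval Y f \<and> f ` K \<subseteq> U} | K U.
          compactin unit_interval K \<and> openin Y U} =
        {f \<in> extensional {0..1}. continuous_map unit_interval Y f}" (is "\<Union>?S = ?C")
  proof
    have "{f \<in> extensional {0..1}. continuous_map unit_interval Y f \<and> f ` {} \<subseteq> {}} \<in> ?S"
      using compactin_empty openin_empty by blast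
    then show "?C \<subseteq> \<Union>?S" by auto
  qed auto
  then show ?thesis
    by (auto simp: loop_space_def compact_open_topology_def)
qed

text \<open>
  One half of the exponential law. Evaluation is jointly continuous because each point of the
  interval has arbitrarily small compact neighbourhoods \<open>K\<close>: the condition \<open>f b ` K \<subseteq> U\<close> is open
  in the parameter \<open>b\<close> by the definition of the compact-open topology.
\<close>
lemma continuous_map_loop_space_eval:
  assumes f: "continuous_map B (loop_space Y y) f"
  shows "continuous_map (prod_topology B unit_interval) Y (\<lambda>(b, t). f b t)"
proof -
  have fb: "continuous_map unit_interval Y (f b)" if "b \<in> topspace B" for b
    using continuous_map_image_subset_topspace[OF f] that by (auto simp: topspace_loop_space)
  have "openin (prod_topology B unit_interval)
          {z \<in> topspace (prod_topology B unit_interval). (case z of (b, t) \<Rightarrow> f b t) \<in> U}"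
    if U: "openin Y U" for U
  proof (subst openin_subopen, clarsimp)
    fix b0 and t0 :: real
    assume b0: "b0 \<in> topspace B" and t0: "0 \<le> t0" "t0 \<le> 1" and fU: "f b0 t0 \<in> U"
    have "openin unit_interval {t \<in> topspace unit_interval. f b0 t \<in> U}"
      using fb[OF b0] U by (rule openin_continuous_map_preimage)
    then obtain d where d: "d > 0" "cball t0 d \<inter> {0..1} \<subseteq> {t \<in> {0..1}. f b0 t \<in> U}"
    proof -
      have "t0 \<in> {t \<in> topspace unit_interval. f b0 t \<in> U}"
        using t0 fU by simp
      with \<open>openin unit_interval _\<close> have "\<exists>d>0. cball t0 d \<inter> {0..1} \<subseteq> {t \<in> topspace unit_interval. f b0 t \<in> U}"
        unfolding openin_contains_cball by blast
      then show ?thesis using that by auto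
    qed
    define K where "K = cball t0 d \<inter> {0..1}"
    have K: "compactin unit_interval K"
      by (simp add: K_def compactin_subtopology compact_Int_closed)
    define W where "W = {b \<in> topspace B. f b \<in> {l \<in> extensional {0..1}. continuous_map unit_interval Y l \<and> l ` K \<subseteq> U}}"
    have "continuous_map B (compact_open_topology unit_interval Y) f"
      using f by (simp add: loop_space_def continuous_map_in_subtopology)
    moreover have "openin (compact_open_topology unit_interval Y)
        {l \<in> extensional {0..1}. continuous_map unit_interval Y l \<and> l ` K \<subseteq> U}"
      unfolding compact_open_topology_def
      by (rule topology_generated_by_Basis) (use K U in auto)
    ultimately have "openin B W"
      unfolding W_def by (rule openin_continuous_map_preimage)
    moreover have "openin unit_interval (ball t0 d \<inter> {0..1})"
      by (metis Int_commute open_ball openin_open_Int)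
    ultimately have "openin (prod_topology B unit_interval) (W \<times> (ball t0 d \<inter> {0..1}))"
      by (simp add: openin_prod_Times_iff)
    moreover have "b0 \<in> W"
      using continuous_map_image_subset_topspace[OF f] b0 d
      by (auto simp: W_def topspace_loop_space K_def)
    moreover have "W \<times> (ball t0 d \<inter> {0..1}) \<subseteq> {z. fst z \<in> topspace B \<and> snd z \<in> {0..1} \<and> f (fst z) (snd z) \<in> U}"
      by (auto simp: W_def K_def)
    ultimately show "\<exists>T. openin (prod_topology B unit_interval) T \<and> (b0, t0) \<in> T \<and>
         T \<subseteq> {z. z \<in> topspace B \<times> {0..1} \<and> (case z of (b, t) \<Rightarrow> f b t) \<in> U}"
      using t0 d by (intro exI[of _ "W \<times> (ball t0 d \<inter> {0..1})"]) auto
  qed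
  moreover have "f b t \<in> topspace Y" if "b \<in> topspace B" "t \<in> {0..1}" for b t
    using continuous_map_image_subset_topspace[OF fb[OF that(1)]] that by auto
  ultimately show ?thesis
    by (auto simp: continuous_map_def)
qed

text \<open>
  The other half of the exponential law. The preimage of a subbasic open set \<open>{l. l ` K \<subseteq> U}\<close> is
  open by the tube lemma, applied to the compact slice \<open>{b} \<times> K\<close>.
\<close>
lemma continuous_map_into_loop_space:
  assumes F: "continuous_map (prod_topology B unit_interval) Y (\<lambda>(b, t). f b t)"
    and ends: "\<And>b. b \<in> topspace B \<Longrightarrow> f b \<in> extensional {0..1} \<and> f b 0 = y \<and> f b 1 = y"
  shows "continuous_map B (loop_space Y y) f"
proof -
  have fb: "continuous_map unit_interval Y (f b)" if "b \<in> topspace B" for b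
  proof -
    have "continuous_map unit_interval (prod_topology B unit_interval) (\<lambda>t. (b, t))"
      using that by (simp add: continuous_map_pairedI)
    from continuous_map_compose[OF this F] show ?thesis by (simp add: o_def)
  qed
  have "continuous_map B (compact_open_topology unit_interval Y) f"
    unfolding compact_open_topology_def
  proof (rule continuous_on_generated_topo)
    fix S
    assume "S \<in> {{f \<in> extensional (topspace unit_interval). continuous_map unit_interval Y f \<and> f ` K \<subseteq> U} |K U.
                  compactin unit_interval K \<and> openin Y U}"
    then obtain K U where S: "S = {f \<in> extensional {0..1}. continuous_map unit_interval Y f \<and> f ` K \<subseteq> U}"
      and K: "compactin unit_interval K" and U: "openin Y U" by auto
    have K01: "K \<subseteq> {0..1}" using compactin_subset_topspace[OF K] by simp
    define W where "W = {z \<in> topspace (prod_topology B unit_interval). (case z of (b, t) \<Rightarrow> f b t) \<in> U}"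
    have W: "openin (prod_topology B unit_interval) W"
      unfolding W_def using F U by (rule openin_continuous_map_preimage)
    have "\<exists>T. openin B T \<and> b0 \<in> T \<and> T \<subseteq> f -` S \<inter> topspace B" if b0: "b0 \<in> f -` S \<inter> topspace B" for b0
    proof -
      have "{b0} \<times> K \<subseteq> W" using b0 K01 by (auto simp: S W_def)
      then obtain T V where "openin B T" "b0 \<in> T" "K \<subseteq> V" "T \<times> V \<subseteq> W"
        using tube_lemma_right[OF W K, of b0] b0 by auto
      moreover have "T \<subseteq> f -` S \<inter> topspace B"
      proof
        fix b assume "b \<in> T"
        then have "b \<in> topspace B" using \<open>openin B T\<close> openin_subset by blast
        moreover have "f b ` K \<subseteq> U"
          using \<open>b \<in> T\<close> \<open>K \<subseteq> V\<close> \<open>T \<times> V \<subseteq> W\<close> by (fastforce simp: W_def)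
        ultimately show "b \<in> f -` S \<inter> topspace B"
          using fb ends by (simp add: S)
      qed
      ultimately show ?thesis by blast
    qed
    then show "openin B (f -` S \<inter> topspace B)"
      by (subst openin_subopen) blast
  next
    have "{f \<in> extensional {0..1}. continuous_map unit_interval Y f \<and> f ` {} \<subseteq> {}} \<in> {{f \<in> extensional (topspace unit_interval). continuous_map unit_interval Y f \<and> f ` K \<subseteq> U} |K U.
                  compactin unit_interval K \<and> openin Y U}" (is "?C \<in> ?S")
      using compactin_empty openin_empty by fastforce
    moreover have "f ` topspace B \<subseteq> ?C" using fb ends by auto
    ultimately show "f ` topspace B \<subseteq> \<Union>?S" by blast
  qed
  then show ?thesis
    using ends by (auto simp: loop_space_def continuous_map_in_subtopology)
qed

text \<open>
  The form in which the exponential law is applied: loops are required to be extensional, so a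
  family given by a formula has to be cut down to the interval.
\<close>
lemma continuous_map_into_loop_space_restrict:
  assumes "continuous_map (prod_topology B unit_interval) Y (\<lambda>(b, t). F b t)"
    and "\<And>b. b \<in> topspace B \<Longrightarrow> F b 0 = y \<and> F b 1 = y"
  shows "continuous_map B (loop_space Y y) (\<lambda>b. restrict (F b) {0..1})"
proof (rule continuous_map_into_loop_space)
  show "continuous_map (prod_topology B unit_interval) Y (\<lambda>(b, t). restrict (F b) {0..1} t)"
    using assms(1) by (rule continuous_map_eq) auto
qed (use assms(2) in auto)

lemma continuous_map_loop_space_eval_at:
  assumes "continuous_map B (loop_space Y y) f" "continuous_map Z B p" "continuous_map Z unit_interval \<tau>"
  shows "continuous_map Z Y (\<lambda>z. f (p z) (\<tau> z))"
proof -
  have "continuous_map Z (prod_topology B unit_interval) (\<lambda>z. (p z, \<tau> z))"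
    using assms by (simp add: continuous_map_pairedI)
  from continuous_map_compose[OF this continuous_map_loop_space_eval[OF assms(1)]]
  show ?thesis by (simp add: o_def)
qed

lemma continuous_map_unit_interval_real:
  "continuous_map Z unit_interval \<tau> \<Longrightarrow> continuous_map Z euclideanreal \<tau>"
  by (simp add: continuous_map_in_subtopology)

lemma continuous_map_reparametrise:
  assumes "continuous_on {0..1} \<phi>" "continuous_map Z unit_interval \<tau>"
  shows "continuous_map Z euclideanreal (\<lambda>z. \<phi> (\<tau> z))"
  using continuous_map_compose[OF assms(2), of euclideanreal \<phi>] assms(1) by (simp add: o_def)

lemma loop_space_map_at:
  assumes "continuous_map B (loop_space Y y) f" "b \<in> topspace B"
  shows "f b 0 = y" "f b 1 = y" "f b \<in> extensional {0..1}" "continuous_map unit_interval Y (f b)"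
  using continuous_map_image_subset_topspace[OF assms(1)] assms(2)
  by (auto simp: topspace_loop_space)

lemma const_loop_in_loop_space:
  "y \<in> topspace Y \<Longrightarrow> const_loop y \<in> topspace (loop_space Y y)"
  by (auto simp: topspace_loop_space const_loop_def intro: continuous_map_eq[where f="\<lambda>_. y"])

lemma continuous_map_loop_mult:
  assumes f: "continuous_map B (loop_space Y y) f" and g: "continuous_map B (loop_space Y y) g"
  shows "continuous_map B (loop_space Y y) (\<lambda>b. loop_mult (f b) (g b))"
  unfolding loop_mult_def
proof (rule continuous_map_into_loop_space_restrict)
  let ?Z = "prod_topology B unit_interval"
  have Z: "continuous_map ?Z B fst" "continuous_map ?Z unit_interval snd"
    by (auto intro: continuous_map_fst continuous_map_snd)
  have Zr: "continuous_map ?Z euclideanreal snd"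
    using Z(2) by (rule continuous_map_unit_interval_real)
  have *: "continuous_map ?Z Y (\<lambda>z. if snd z \<le> 1/2 then f (fst z) (2 * snd z) else g (fst z) (2 * snd z - 1))"
  proof (rule continuous_map_cases_le)
    show "continuous_map (subtopology ?Z {z \<in> topspace ?Z. snd z \<le> 1/2}) Y (\<lambda>z. f (fst z) (2 * snd z))"
      by (rule continuous_map_loop_space_eval_at[OF f])
         (auto intro!: continuous_map_from_subtopology Z continuous_map_real_mult_left Zr
            simp: continuous_map_in_subtopology[of _ euclideanreal])
    show "continuous_map (subtopology ?Z {z \<in> topspace ?Z. 1/2 \<le> snd z}) Y (\<lambda>z. g (fst z) (2 * snd z - 1))"
      by (rule continuous_map_loop_space_eval_at[OF g])
         (auto intro!: continuous_map_from_subtopology Z continuous_map_real_mult_left Zr continuous_map_diff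
            simp: continuous_map_in_subtopology[of _ euclideanreal])
    show "f (fst z) (2 * snd z) = g (fst z) (2 * snd z - 1)" if "z \<in> topspace ?Z" "snd z = 1/2" for z
    proof -
      have half: "2 * snd z = 1" using that by simp
      show ?thesis
        unfolding half using that loop_space_map_at(2)[OF f, of "fst z"] loop_space_map_at(1)[OF g, of "fst z"] by auto
    qed
  qed (use Zr in auto)
  then show "continuous_map ?Z Y (\<lambda>(b, t). if t \<le> 1/2 then f b (2 * t) else g b (2 * t - 1))"
    by (simp add: case_prod_unfold)
qed (use loop_space_map_at[OF f] loop_space_map_at[OF g] in auto)


section \<open>Groups of maps into a loop space\<close>

lemma loop_mult_const [simp]: "loop_mult (const_loop y) (const_loop y) = const_loop y"
  by (auto simp: loop_mult_def const_loop_def fun_eq_iff)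

abbreviation pointed_homotopic where
  "pointed_homotopic A a Y y \<equiv> homotopic_with (\<lambda>h. h a = y) A Y"

text \<open>
  The source of all the homotopies behind the group laws. Two reparametrisations \<open>\<phi>\<close> and \<open>\<psi>\<close> of
  the interval with the same end values are joined by the straight line between them, since the
  interval is convex; requiring the end values to be \<open>0\<close> or \<open>1\<close> makes every intermediate path a loop
  at the base point. The parameter \<open>b\<close> enters only through \<open>f b\<close>, so the homotopy is continuous in it.
\<close>
lemma homotopic_reparametrisations:
  fixes \<phi> \<psi> :: "real \<Rightarrow> real"
  assumes f: "f \<in> pointed_maps B a (loop_space Y y) (const_loop y)"
    and cont: "continuous_on {0..1} \<phi>" "continuous_on {0..1} \<psi>"
    and into: "\<phi> ` {0..1} \<subseteq> {0..1}" "\<psi> ` {0..1} \<subseteq> {0..1}"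
    and ends: "\<phi> 0 = \<psi> 0" "\<phi> 0 \<in> {0, 1}" "\<phi> 1 = \<psi> 1" "\<phi> 1 \<in> {0, 1}"
  shows "pointed_homotopic B a (loop_space Y y) (const_loop y)
           (\<lambda>b. restrict (\<lambda>t. f b (\<phi> t)) {0..1}) (\<lambda>b. restrict (\<lambda>t. f b (\<psi> t)) {0..1})"
proof -
  have f: "continuous_map B (loop_space Y y) f" "f a = const_loop y"
    using f by (auto simp: pointed_maps_def)
  let ?\<rho> = "\<lambda>u t. (1 - u) * \<phi> t + u * \<psi> t"
  have \<rho>: "?\<rho> u t \<in> {0..1}" if "u \<in> {0..1}" "t \<in> {0..1}" for u t
  proof -
    have "\<phi> t \<in> {0..1}" "\<psi> t \<in> {0..1}" using into that by (auto simp only: image_subset_iff)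
    then show ?thesis
      using convexD_alt[of "{0..1::real}" "\<phi> t" "\<psi> t" u] that by auto
  qed
  let ?h = "\<lambda>z. restrict (\<lambda>t. f (snd z) (?\<rho> (fst z) t)) {0..1}"
  have "continuous_map (prod_topology unit_interval B) (loop_space Y y) ?h"
  proof (rule continuous_map_into_loop_space_restrict)
    let ?Z = "prod_topology (prod_topology unit_interval B) unit_interval"
    have Z: "continuous_map ?Z unit_interval (\<lambda>z. fst (fst z))" "continuous_map ?Z B (\<lambda>z. snd (fst z))"
       "continuous_map ?Z unit_interval snd"
      by (rule continuous_map_compose[OF continuous_map_fst continuous_map_fst, unfolded o_def],
          rule continuous_map_compose[OF continuous_map_fst continuous_map_snd, unfolded o_def],
          rule continuous_map_snd)
    have "continuous_map ?Z euclideanreal (\<lambda>z. ?\<rho> (fst (fst z)) (snd z))"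
      by (intro continuous_map_add continuous_map_real_mult continuous_map_diff
            continuous_map_reparametrise[OF _ Z(3)] cont)
         (use continuous_map_unit_interval_real[OF Z(1)] in auto)
    then have "continuous_map ?Z unit_interval (\<lambda>z. ?\<rho> (fst (fst z)) (snd z))"
      using \<rho> by (auto simp: continuous_map_in_subtopology simp del: atLeastAtMost_iff)
    from continuous_map_loop_space_eval_at[OF f(1) Z(2) this]
    show "continuous_map ?Z Y (\<lambda>(z, t). f (snd z) (?\<rho> (fst z) t))"
      by (simp add: case_prod_unfold)
    show "f (snd z) (?\<rho> (fst z) 0) = y \<and> f (snd z) (?\<rho> (fst z) 1) = y"
      if "z \<in> topspace (prod_topology unit_interval B)" for z
      using that ends loop_space_map_at[OF f(1)] by auto
  qed
  moreover have "?h (u, a) = const_loop y" if "u \<in> {0..1}" for u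
    using \<rho>[OF that] by (auto simp: f(2) const_loop_def fun_eq_iff)
  ultimately show ?thesis
    unfolding homotopic_with_def by (intro exI[of _ ?h]) auto
qed

lemma pointed_homotopic_loop_mult:
  assumes "pointed_homotopic A a (loop_space Y y) (const_loop y) f f'"
    and "pointed_homotopic A a (loop_space Y y) (const_loop y) g g'"
  shows "pointed_homotopic A a (loop_space Y y) (const_loop y)
           (\<lambda>x. loop_mult (f x) (g x)) (\<lambda>x. loop_mult (f' x) (g' x))"
proof -
  obtain h k where
    h: "continuous_map (prod_topology unit_interval A) (loop_space Y y) h"
      "\<forall>x. h (0, x) = f x" "\<forall>x. h (1, x) = f' x" "\<forall>t\<in>{0..1}. h (t, a) = const_loop y" and
    k: "continuous_map (prod_topology unit_interval A) (loop_space Y y) k"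
      "\<forall>x. k (0, x) = g x" "\<forall>x. k (1, x) = g' x" "\<forall>t\<in>{0..1}. k (t, a) = const_loop y"
    using assms unfolding homotopic_with_def by blast
  show ?thesis
    unfolding homotopic_with_def
    by (rule exI[of _ "\<lambda>z. loop_mult (h z) (k z)"]) (use h k in \<open>auto intro: continuous_map_loop_mult\<close>)
qed

lemma pointed_class_eqI:
  "pointed_homotopic A a Y y f g \<Longrightarrow> pointed_class A a Y y f = pointed_class A a Y y g"
  unfolding pointed_class_def by (auto intro: homotopic_with_trans homotopic_with_symD)

lemma pointed_class_self:
  "f \<in> pointed_maps A a Y y \<Longrightarrow> f \<in> pointed_class A a Y y f"
  by (simp add: pointed_class_def pointed_maps_def)

text \<open>
  Operations on homotopy classes are unions over representatives. This evaluates such a union once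
  the operation is known not to depend on the representative.
\<close>
lemma UN_pointed_class_eq:
  assumes "f \<in> pointed_maps A a Y y"
    and "\<And>f'. pointed_homotopic A a Y y f f' \<Longrightarrow> C f' = C f"
  shows "(\<Union>f'\<in>pointed_class A a Y y f. C f') = C f"
proof -
  have "(\<Union>f'\<in>pointed_class A a Y y f. C f') = (\<Union>f'\<in>pointed_class A a Y y f. C f)"
    by (intro SUP_cong refl assms(2)) (simp add: pointed_class_def)
  then show ?thesis using pointed_class_self[OF assms(1)] by auto
qed

lemma maps_to_loops_group_mult:
  assumes "f \<in> pointed_maps A a (loop_space Y y) (const_loop y)"
    and "g \<in> pointed_maps A a (loop_space Y y) (const_loop y)"
  shows "pointed_class A a (loop_space Y y) (const_loop y) f
           \<otimes>\<^bsub>maps_to_loops_group A a Y y\<^esub> pointed_class A a (loop_space Y y) (const_loop y) g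
         = pointed_class A a (loop_space Y y) (const_loop y) (\<lambda>x. loop_mult (f x) (g x))"
proof -
  let ?C = "pointed_class A a (loop_space Y y) (const_loop y)"
  let ?h = "pointed_homotopic A a (loop_space Y y) (const_loop y)"
  have g: "(\<Union>g'\<in>?C g. ?C (\<lambda>x. loop_mult (f' x) (g' x))) = ?C (\<lambda>x. loop_mult (f' x) (g x))"
    if "?h f f'" for f'
  proof (rule UN_pointed_class_eq[OF assms(2)])
    have "?h f' f'" by (rule homotopic_with_trans[OF homotopic_with_symD[OF that] that])
    then show "?C (\<lambda>x. loop_mult (f' x) (g' x)) = ?C (\<lambda>x. loop_mult (f' x) (g x))"
      if "?h g g'" for g'
      using that by (intro pointed_class_eqI pointed_homotopic_loop_mult homotopic_with_symD[OF that])
  qed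
  have rf: "?h f f" and rg: "?h g g" using assms by (auto simp: pointed_maps_def)
  have "(\<Union>f'\<in>?C f. \<Union>g'\<in>?C g. ?C (\<lambda>x. loop_mult (f' x) (g' x))) =
        (\<Union>g'\<in>?C g. ?C (\<lambda>x. loop_mult (f x) (g' x)))"
  proof (rule UN_pointed_class_eq[OF assms(1)])
    fix f' assume f': "?h f f'"
    have "?C (\<lambda>x. loop_mult (f' x) (g x)) = ?C (\<lambda>x. loop_mult (f x) (g x))"
      by (intro pointed_class_eqI pointed_homotopic_loop_mult homotopic_with_symD[OF f'] rg)
    then show "(\<Union>g'\<in>?C g. ?C (\<lambda>x. loop_mult (f' x) (g' x))) = (\<Union>g'\<in>?C g. ?C (\<lambda>x. loop_mult (f x) (g' x)))"
      by (simp add: g[OF f'] g[OF rf])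
  qed
  then show ?thesis
    by (simp add: maps_to_loops_group_def g[OF rf])
qed

lemma carrier_maps_to_loops_group:
  "carrier (maps_to_loops_group A a Y y) =
     pointed_class A a (loop_space Y y) (const_loop y) ` pointed_maps A a (loop_space Y y) (const_loop y)"
  by (simp add: maps_to_loops_group_def pointed_homotopy_classes_def)

lemma one_maps_to_loops_group:
  "\<one>\<^bsub>maps_to_loops_group A a Y y\<^esub> =
     pointed_class A a (loop_space Y y) (const_loop y) (\<lambda>_. const_loop y)"
  by (simp add: maps_to_loops_group_def)

lemma pointed_maps_loop_mult:
  assumes "f \<in> pointed_maps A a (loop_space Y y) (const_loop y)"
    and "g \<in> pointed_maps A a (loop_space Y y) (const_loop y)"
  shows "(\<lambda>x. loop_mult (f x) (g x)) \<in> pointed_maps A a (loop_space Y y) (const_loop y)"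
  using assms by (auto simp: pointed_maps_def intro: continuous_map_loop_mult)

lemma pointed_class_reparametrisation:
  fixes \<phi> \<psi> :: "real \<Rightarrow> real"
  assumes a: "a \<in> topspace B"
    and f: "f \<in> pointed_maps B a (loop_space Y y) (const_loop y)"
    and cont: "continuous_on {0..1} \<phi>" "continuous_on {0..1} \<psi>"
    and into: "\<phi> ` {0..1} \<subseteq> {0..1}" "\<psi> ` {0..1} \<subseteq> {0..1}"
    and ends: "\<phi> 0 = \<psi> 0" "\<phi> 0 \<in> {0, 1}" "\<phi> 1 = \<psi> 1" "\<phi> 1 \<in> {0, 1}"
    and g: "\<And>b. b \<in> topspace B \<Longrightarrow> g b = restrict (\<lambda>t. f b (\<phi> t)) {0..1}"
    and h: "\<And>b. b \<in> topspace B \<Longrightarrow> h b = restrict (\<lambda>t. f b (\<psi> t)) {0..1}"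
  shows "pointed_class B a (loop_space Y y) (const_loop y) g = pointed_class B a (loop_space Y y) (const_loop y) h"
  by (rule pointed_class_eqI, rule homotopic_with_eq[OF homotopic_reparametrisations[OF f cont into ends]])
     (use g h a in auto)

text \<open>
  Each group law compares two reparametrisations of one family of loops. For associativity,
  \<open>(f g) h\<close> is \<open>f (g h)\<close> run through the piecewise linear map that sends \<open>1/4\<close> to \<open>1/2\<close> and \<open>1/2\<close> to
  \<open>3/4\<close>; its slopes \<open>2, 1, 1/2\<close> decrease, hence it is a minimum of three affine maps. For the unit,
  \<open>f\<close> waits at the base point during the first half. For the inverse, the reversed loop followed by
  the loop traces \<open>f\<close> at time \<open>\<bar>2 t - 1\<bar>\<close>, which starts and ends at \<open>1\<close> and so can be contracted
  to the constant time \<open>1\<close>.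
\<close>
lemma group_maps_to_loops_group:
  assumes a: "a \<in> topspace A" and y: "y \<in> topspace Y"
  shows "group (maps_to_loops_group A a Y y)"
proof -
  let ?G = "maps_to_loops_group A a Y y"
  let ?C = "pointed_class A a (loop_space Y y) (const_loop y)"
  let ?P = "pointed_maps A a (loop_space Y y) (const_loop y)"
  note M = maps_to_loops_group_mult
  note reparam = pointed_class_reparametrisation[OF a]
  have cont: "continuous_map A (loop_space Y y) f" if "f \<in> ?P" for f
    using that by (simp add: pointed_maps_def)
  note at = loop_space_map_at[OF cont]
  have ext: "f b = restrict (f b) {0..1}" if "f \<in> ?P" "b \<in> topspace A" for f b
    using at(3)[OF that] by (simp add: extensional_restrict)
  have one: "(\<lambda>_. const_loop y) \<in> ?P"
    using const_loop_in_loop_space[OF y] by (simp add: pointed_maps_def)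
  show ?thesis
  proof (rule groupI)
    show "\<one>\<^bsub>?G\<^esub> \<in> carrier ?G"
      using one by (simp add: carrier_maps_to_loops_group one_maps_to_loops_group)
  next
    fix c d assume "c \<in> carrier ?G" "d \<in> carrier ?G"
    then show "c \<otimes>\<^bsub>?G\<^esub> d \<in> carrier ?G"
      by (auto simp: carrier_maps_to_loops_group M pointed_maps_loop_mult)
  next
    fix c d e assume "c \<in> carrier ?G" "d \<in> carrier ?G" "e \<in> carrier ?G"
    then obtain f g h where fgh: "f \<in> ?P" "g \<in> ?P" "h \<in> ?P" "c = ?C f" "d = ?C g" "e = ?C h"
      by (auto simp: carrier_maps_to_loops_group)
    let ?\<phi> = "\<lambda>t::real. min (2 * t) (min (t + 1/4) ((t + 1) / 2))"
    have "?C (\<lambda>x. loop_mult (loop_mult (f x) (g x)) (h x)) = ?C (\<lambda>x. loop_mult (f x) (loop_mult (g x) (h x)))"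
    proof (rule reparam[where \<phi> = ?\<phi> and \<psi> = "\<lambda>t. t" and f = "\<lambda>x. loop_mult (f x) (loop_mult (g x) (h x))"])
      show "(\<lambda>x. loop_mult (f x) (loop_mult (g x) (h x))) \<in> ?P"
        using fgh by (intro pointed_maps_loop_mult)
      show "continuous_on {0..1} ?\<phi>"
        by (intro continuous_intros) auto
      fix b assume b: "b \<in> topspace A"
      show "loop_mult (loop_mult (f b) (g b)) (h b) =
          (\<lambda>t\<in>{0..1}. loop_mult (f b) (loop_mult (g b) (h b)) (?\<phi> t))"
      proof
        fix t :: real
        consider "t \<notin> {0..1}" | "0 \<le> t" "t \<le> 1/4" | "1/4 < t" "t \<le> 1/2" | "1/2 < t" "t \<le> 1"
          by fastforce
        then show "loop_mult (loop_mult (f b) (g b)) (h b) t =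
          (\<lambda>t\<in>{0..1}. loop_mult (f b) (loop_mult (g b) (h b)) (?\<phi> t)) t"
        proof cases
          case 2
          then have "?\<phi> t = 2 * t" by (auto simp: min_def)
          with 2 show ?thesis by (auto simp: loop_mult_def)
        next
          case 3
          then have "?\<phi> t = t + 1/4" by (auto simp: min_def)
          with 3 show ?thesis by (auto simp: loop_mult_def algebra_simps)
        next
          case 4
          then have "?\<phi> t = (t + 1) / 2" by (auto simp: min_def field_simps)
          with 4 show ?thesis by (auto simp: loop_mult_def field_simps)
        qed (auto simp: loop_mult_def)
      qed
      show "loop_mult (f b) (loop_mult (g b) (h b)) = (\<lambda>t\<in>{0..1}. loop_mult (f b) (loop_mult (g b) (h b)) t)"
        by (auto simp: loop_mult_def fun_eq_iff)
    qed (auto simp: min_def)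
    with fgh show "c \<otimes>\<^bsub>?G\<^esub> d \<otimes>\<^bsub>?G\<^esub> e = c \<otimes>\<^bsub>?G\<^esub> (d \<otimes>\<^bsub>?G\<^esub> e)"
      by (simp add: M pointed_maps_loop_mult)
  next
    fix c assume "c \<in> carrier ?G"
    then obtain f where f: "f \<in> ?P" "c = ?C f" by (auto simp: carrier_maps_to_loops_group)
    have "?C (\<lambda>x. loop_mult (const_loop y) (f x)) = ?C f"
    proof (rule reparam[OF f(1), where \<phi> = "\<lambda>t. max 0 (2 * t - 1)" and \<psi> = "\<lambda>t. t"])
      show "continuous_on {0..1} (\<lambda>t::real. max 0 (2 * t - 1))"
        by (intro continuous_intros)
      fix b assume b: "b \<in> topspace A"
      show "loop_mult (const_loop y) (f b) = (\<lambda>t\<in>{0..1}. f b (max 0 (2 * t - 1)))"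
      proof
        fix t :: real
        show "loop_mult (const_loop y) (f b) t = (\<lambda>t\<in>{0..1}. f b (max 0 (2 * t - 1))) t"
        proof (cases "t \<le> 1/2")
          case True
          then have "max 0 (2 * t - 1) = 0" by simp
          with True show ?thesis
            using at(1)[OF f(1) b] by (simp add: loop_mult_def const_loop_def)
        next
          case False
          then have "max 0 (2 * t - 1) = 2 * t - 1" by simp
          with False show ?thesis by (simp add: loop_mult_def)
        qed
      qed
      show "f b = (\<lambda>t\<in>{0..1}. f b t)" using ext[OF f(1) b] by simp
    qed auto
    then show "\<one>\<^bsub>?G\<^esub> \<otimes>\<^bsub>?G\<^esub> c = c"
      by (simp add: f one_maps_to_loops_group M one)
    let ?r = "\<lambda>x. \<lambda>t\<in>{0..1}. f x (1 - t)"
    have r: "?r \<in> ?P"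
    proof -
      have "continuous_map (prod_topology A unit_interval) Y (\<lambda>z. f (fst z) (1 - snd z))"
      proof (rule continuous_map_loop_space_eval_at[OF cont[OF f(1)] continuous_map_fst])
        have "continuous_map (prod_topology A unit_interval) euclideanreal (\<lambda>z. 1 - snd z)"
          by (rule continuous_map_reparametrise[OF _ continuous_map_snd]) (intro continuous_intros)
        then show "continuous_map (prod_topology A unit_interval) unit_interval (\<lambda>z. 1 - snd z)"
          by (auto simp: continuous_map_in_subtopology)
      qed
      then have "continuous_map A (loop_space Y y) ?r"
        using at(1,2)[OF f(1)]
        by (intro continuous_map_into_loop_space_restrict) (auto simp: case_prod_unfold)
      moreover have "?r a = const_loop y"
        using f(1) by (auto simp: pointed_maps_def const_loop_def fun_eq_iff)
      ultimately show ?thesis by (simp add: pointed_maps_def)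
    qed
    have "?C (\<lambda>x. loop_mult (?r x) (f x)) = ?C (\<lambda>_. const_loop y)"
    proof (rule reparam[OF f(1), where \<phi> = "\<lambda>t. \<bar>2 * t - 1\<bar>" and \<psi> = "\<lambda>t. 1"])
      show "continuous_on {0..1} (\<lambda>t::real. \<bar>2 * t - 1\<bar>)"
        by (intro continuous_intros)
      fix b assume b: "b \<in> topspace A"
      show "loop_mult (?r b) (f b) = (\<lambda>t\<in>{0..1}. f b \<bar>2 * t - 1\<bar>)"
      proof
        fix t :: real
        have "\<bar>2 * t - 1\<bar> = (if t \<le> 1/2 then 1 - 2 * t else 2 * t - 1)" by auto
        then show "loop_mult (?r b) (f b) t = (\<lambda>t\<in>{0..1}. f b \<bar>2 * t - 1\<bar>) t"
          by (auto simp: loop_mult_def)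
      qed
      show "const_loop y = (\<lambda>t\<in>{0..1}. f b 1)" using at(2)[OF f(1) b] by (simp add: const_loop_def)
    qed auto
    then have "?C ?r \<otimes>\<^bsub>?G\<^esub> c = \<one>\<^bsub>?G\<^esub>"
      by (simp add: f one_maps_to_loops_group M r)
    then show "\<exists>d\<in>carrier ?G. d \<otimes>\<^bsub>?G\<^esub> c = \<one>\<^bsub>?G\<^esub>"
      using r by (auto simp: carrier_maps_to_loops_group)
  qed
qed


section \<open>Covering maps and the lifting of homotopies\<close>

text \<open>
  Formulated for abstract topologies, since an orbit space is a topology on a type of sets.
\<close>
definition covering_map :: "'a topology \<Rightarrow> 'b topology \<Rightarrow> ('a \<Rightarrow> 'b) \<Rightarrow> bool" where
  "covering_map X Y q \<longleftrightarrow>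
     continuous_map X Y q \<and>
     (\<forall>y\<in>topspace Y. \<exists>V \<U>. openin Y V \<and> y \<in> V \<and> pairwise disjnt \<U> \<and>
        \<Union>\<U> = {x \<in> topspace X. q x \<in> V} \<and>
        (\<forall>U\<in>\<U>. openin X U \<and> homeomorphic_map (subtopology X U) (subtopology Y V) q))"

text \<open>
  The sheets in the form needed for lifting: on each sheet the map is injective and has a continuous
  local inverse \<open>s\<close>.
\<close>
lemma covering_map_evenly_covered:
  assumes "covering_map X Y q" "y \<in> topspace Y"
  obtains V \<U> where "openin Y V" "y \<in> V" "pairwise disjnt \<U>" "\<Union>\<U> = {x \<in> topspace X. q x \<in> V}"
    "\<And>U. U \<in> \<U> \<Longrightarrow> openin X U" "\<And>U. U \<in> \<U> \<Longrightarrow> inj_on q U"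
    "\<And>U. U \<in> \<U> \<Longrightarrow> \<exists>s. continuous_map (subtopology Y V) (subtopology X U) s \<and> (\<forall>x\<in>U. s (q x) = x) \<and> (\<forall>v\<in>V. q (s v) = v)"
proof -
  have "\<exists>V \<U>. openin Y V \<and> y \<in> V \<and> pairwise disjnt \<U> \<and> \<Union>\<U> = {x \<in> topspace X. q x \<in> V} \<and>
        (\<forall>U\<in>\<U>. openin X U \<and> homeomorphic_map (subtopology X U) (subtopology Y V) q)"
    using assms by (simp add: covering_map_def)
  then obtain V \<U> where *: "openin Y V" "y \<in> V" "pairwise disjnt \<U>" "\<Union>\<U> = {x \<in> topspace X. q x \<in> V}"
    and "\<forall>U\<in>\<U>. openin X U \<and> homeomorphic_map (subtopology X U) (subtopology Y V) q"
    by (elim exE conjE)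
  then have **: "openin X U" "homeomorphic_map (subtopology X U) (subtopology Y V) q" if "U \<in> \<U>" for U
    using that by simp_all
  have top: "topspace (subtopology X U) = U" "topspace (subtopology Y V) = V" if "U \<in> \<U>" for U
    using openin_subset[OF *(1)] openin_subset[OF **(1)[OF that]] by auto
  have "inj_on q U" if "U \<in> \<U>" for U
    using homeomorphic_imp_injective_map[of "subtopology X U"] **(2)[OF that] top[OF that] by metis
  moreover have "\<exists>s. continuous_map (subtopology Y V) (subtopology X U) s \<and> (\<forall>x\<in>U. s (q x) = x) \<and> (\<forall>v\<in>V. q (s v) = v)"
    if U: "U \<in> \<U>" for U
  proof -
    obtain s where "homeomorphic_maps (subtopology X U) (subtopology Y V) q s"
      using **(2)[OF U] by (auto simp: homeomorphic_map_maps)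
    then show ?thesis
      unfolding homeomorphic_maps_def top[OF U] by (intro exI[of _ s]) simp
  qed
  ultimately show thesis by (intro that[OF * **(1)])
qed

text \<open>
  The set where two lifts agree is clopen. Near a point of agreement both lifts stay in one sheet,
  where the covering map is injective; near a point of disagreement they stay in two disjoint sheets.
\<close>
lemma covering_map_lift_unique:
  assumes cov: "covering_map X Y q" and B: "connected_space B"
    and f: "continuous_map B X f" and g: "continuous_map B X g"
    and eq: "\<And>b. b \<in> topspace B \<Longrightarrow> q (f b) = q (g b)"
    and b0: "b0 \<in> topspace B" "f b0 = g b0" and b: "b \<in> topspace B"
  shows "f b = g b"
proof -
  have fX: "f b \<in> topspace X" "g b \<in> topspace X" if "b \<in> topspace B" for b
    using that f g continuous_map_image_subset_topspace by blast+
  have q: "continuous_map X Y q" using cov by (simp add: covering_map_def)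
  have loc: "\<exists>N. openin B N \<and> b \<in> N \<and> ((\<forall>b'\<in>N. f b' = g b') \<or> (\<forall>b'\<in>N. f b' \<noteq> g b') )
      " if b: "b \<in> topspace B" for b
  proof -
    have "q (f b) \<in> topspace Y"
      using fX[OF b] q continuous_map_image_subset_topspace by blast
    then obtain V \<U> where
      V: "openin Y V" "q (f b) \<in> V" "pairwise disjnt \<U>" "\<Union>\<U> = {x \<in> topspace X. q x \<in> V}" and
      \<U>: "\<And>U. U \<in> \<U> \<Longrightarrow> openin X U" "\<And>U. U \<in> \<U> \<Longrightarrow> inj_on q U"
         "\<And>U. U \<in> \<U> \<Longrightarrow> \<exists>s. continuous_map (subtopology Y V) (subtopology X U) s \<and> (\<forall>x\<in>U. s (q x) = x) \<and> (\<forall>v\<in>V. q (s v) = v)"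
      by (rule covering_map_evenly_covered[OF cov]) (rule that; assumption)
    obtain U1 U2 where U: "U1 \<in> \<U>" "f b \<in> U1" "U2 \<in> \<U>" "g b \<in> U2"
    proof -
      have "f b \<in> \<Union>\<U>" "g b \<in> \<Union>\<U>" using V fX[OF b] eq[OF b] by auto
      then show ?thesis using that by blast
    qed
    define N where "N = {b' \<in> topspace B. f b' \<in> U1} \<inter> {b' \<in> topspace B. g b' \<in> U2}"
    have "openin B N"
      unfolding N_def by (intro openin_Int openin_continuous_map_preimage[OF f] openin_continuous_map_preimage[OF g] \<U> U)
    moreover have "b \<in> N" using b U by (simp add: N_def)
    moreover have "(\<forall>b'\<in>N. f b' = g b') \<or> (\<forall>b'\<in>N. f b' \<noteq> g b')"
    proof (cases "U1 = U2")
      case True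
      then show ?thesis using \<U>(2)[OF U(1)] eq by (auto simp: N_def inj_on_def)
    next
      case False
      then have "disjnt U1 U2" using V(3) U by (metis pairwiseD)
      then show ?thesis by (auto simp: N_def disjnt_iff)
    qed
    ultimately show ?thesis by blast
  qed
  define S where "S = {b \<in> topspace B. f b = g b}"
  have "openin B S"
  proof (subst openin_subopen, intro ballI)
    fix b assume b: "b \<in> S"
    then obtain N where N: "openin B N" "b \<in> N" "(\<forall>b'\<in>N. f b' = g b') \<or> (\<forall>b'\<in>N. f b' \<noteq> g b')"
      using loc by (auto simp: S_def)
    then have "N \<subseteq> S" using b openin_subset[OF N(1)] by (auto simp: S_def)
    with N show "\<exists>T. openin B T \<and> b \<in> T \<and> T \<subseteq> S" by blast
  qed
  moreover have "openin B (topspace B - S)"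
  proof (subst openin_subopen, intro ballI)
    fix b assume b: "b \<in> topspace B - S"
    then obtain N where N: "openin B N" "b \<in> N" "(\<forall>b'\<in>N. f b' = g b') \<or> (\<forall>b'\<in>N. f b' \<noteq> g b')"
      using loc by blast
    then have "N \<subseteq> topspace B - S" using b openin_subset[OF N(1)] by (auto simp: S_def)
    with N show "\<exists>T. openin B T \<and> b \<in> T \<and> T \<subseteq> topspace B - S" by blast
  qed
  ultimately have "S = {} \<or> S = topspace B"
    using B by (auto simp: connected_space_clopen_in closedin_def S_def)
  then show ?thesis using b0 b by (auto simp: S_def)
qed

text \<open>
  Near one parameter \<open>b0\<close> the lift is extended along the interval. Let \<open>P t\<close> say that there is a lift
  up to time \<open>t\<close> over some neighbourhood of \<open>b0\<close>. A time \<open>t\<close> has a neighbourhood \<open>T\<close> such that the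
  homotopy maps \<open>N1 \<times> T\<close> into one evenly covered set; inside \<open>T\<close> a lift up to \<open>x\<close> continues up to any
  \<open>y\<close> with the local inverse on the sheet that contains its value at \<open>(b0, x)\<close>, after shrinking the
  neighbourhood of \<open>b0\<close>. Hence \<open>P\<close> is locally constant on the interval, and the connectedness of the
  interval carries it from \<open>0\<close> to \<open>1\<close> without choosing a subdivision.
\<close>
lemma covering_map_local_homotopy_lift:
  assumes cov: "covering_map X Y q"
    and F: "continuous_map (prod_topology B unit_interval) Y F"
    and f0: "continuous_map B X f0" "\<And>b. b \<in> topspace B \<Longrightarrow> q (f0 b) = F (b, 0)"
    and b0: "b0 \<in> topspace B"
  shows "\<exists>N G. openin B N \<and> b0 \<in> N \<and>
           continuous_map (subtopology (prod_topology B unit_interval) (N \<times> {0..1})) X G \<and>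
           (\<forall>b\<in>N. \<forall>u\<in>{0..1}. q (G (b, u)) = F (b, u)) \<and> (\<forall>b\<in>N. G (b, 0) = f0 b)"
proof -
  let ?W = "prod_topology B unit_interval"
  define P where "P = (\<lambda>t::real. \<exists>N G. openin B N \<and> b0 \<in> N \<and>
           continuous_map (subtopology ?W (N \<times> {0..t})) X G \<and>
           (\<forall>b\<in>N. \<forall>u\<in>{0..t}. q (G (b, u)) = F (b, u)) \<and> (\<forall>b\<in>N. G (b, 0) = f0 b))"
  have P0: "P 0"
  proof -
    have "continuous_map (subtopology ?W (topspace B \<times> {0..0})) X (\<lambda>z. f0 (fst z))"
      using continuous_map_compose[OF continuous_map_fst f0(1)]
      by (intro continuous_map_from_subtopology) (simp add: o_def)
    then show ?thesis
      unfolding P_def using b0 f0(2) by (intro exI[of _ "topspace B"] exI[of _ "\<lambda>z. f0 (fst z)"]) auto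
  qed
  have "P 1"
  proof (rule connected_induction_simple[of "{0..1::real}" 0 1 P, OF _ _ _ P0])
    fix t :: real assume t: "t \<in> {0..1}"
    have "F (b0, t) \<in> topspace Y"
      using continuous_map_image_subset_topspace[OF F] b0 t by auto
    then obtain V \<U> where
      V: "openin Y V" "F (b0, t) \<in> V" "pairwise disjnt \<U>" "\<Union>\<U> = {x \<in> topspace X. q x \<in> V}" and
      \<U>: "\<And>U. U \<in> \<U> \<Longrightarrow> openin X U" "\<And>U. U \<in> \<U> \<Longrightarrow> inj_on q U"
         "\<And>U. U \<in> \<U> \<Longrightarrow> \<exists>s. continuous_map (subtopology Y V) (subtopology X U) s \<and> (\<forall>x\<in>U. s (q x) = x) \<and> (\<forall>v\<in>V. q (s v) = v)"
      by (rule covering_map_evenly_covered[OF cov]) (rule that; assumption)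
    have "openin ?W {z \<in> topspace ?W. F z \<in> V}"
      using F V(1) by (rule openin_continuous_map_preimage)
    moreover have "(b0, t) \<in> {z \<in> topspace ?W. F z \<in> V}" using b0 t V by simp
    ultimately obtain N1 T' where N1: "openin B N1" "b0 \<in> N1" and T': "openin unit_interval T'" "t \<in> T'"
      and sub: "N1 \<times> T' \<subseteq> {z \<in> topspace ?W. F z \<in> V}"
      unfolding openin_prod_topology_alt by blast
    obtain d where d: "d > 0" "ball t d \<inter> {0..1} \<subseteq> T'"
      using T' unfolding openin_contains_ball by blast
    define T where "T = ball t d \<inter> {0..1}"
    have T: "openin unit_interval T" "t \<in> T"
      using d t unfolding T_def by (metis Int_commute open_ball openin_open_Int, simp)
    have mid: "{x..y} \<subseteq> T" if "x \<in> T" "y \<in> T" for x y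
      using that by (auto simp: T_def dist_real_def)
    have T01: "T \<subseteq> {0..1}" by (simp add: T_def)
    have FV: "F (b, u) \<in> V" if "b \<in> N1" "u \<in> T" for b u
    proof -
      have "(b, u) \<in> N1 \<times> T'" using d that by (auto simp: T_def)
      then show ?thesis using sub by blast
    qed
    have step: "P y" if x: "x \<in> T" and y: "y \<in> T" and Px: "P x" for x y
    proof -
      obtain N G where N: "openin B N" "b0 \<in> N"
        and G: "continuous_map (subtopology ?W (N \<times> {0..x})) X G"
          "\<And>b u. \<lbrakk>b \<in> N; u \<in> {0..x}\<rbrakk> \<Longrightarrow> q (G (b, u)) = F (b, u)" "\<And>b. b \<in> N \<Longrightarrow> G (b, 0) = f0 b"
        using Px unfolding P_def by blast
      show ?thesis
      proof (cases "y \<le> x")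
        case True
        then have "N \<times> {0..y} \<subseteq> N \<times> {0..x}" by auto
        from continuous_map_from_subtopology_mono[OF G(1) this] show ?thesis
          unfolding P_def using N G True by (intro exI[of _ N] exI[of _ G]) auto
      next
        case False
        have x01: "0 \<le> x" "x \<le> 1" "x < y" "y \<le> 1" using x y T01 False by auto
        have Gx: "continuous_map (subtopology B N) X (\<lambda>b. G (b, x))"
        proof -
          have "continuous_map (subtopology B N) (subtopology ?W (N \<times> {0..x})) (\<lambda>b. (b, x))"
            using x01 openin_subset[OF N(1)]
            by (auto simp: continuous_map_in_subtopology continuous_map_pairedI continuous_map_from_subtopology)
          from continuous_map_compose[OF this G(1)] show ?thesis by (simp add: o_def)
        qed
        have NB: "topspace (subtopology B N) = N" using openin_subset[OF N(1)] by auto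
        have "G (b0, x) \<in> topspace X"
          using continuous_map_image_subset_topspace[OF Gx] N NB by auto
        moreover have "q (G (b0, x)) \<in> V" using FV[OF N1(2) x] G(2)[of b0 x] N x01 by simp
        ultimately obtain U where U: "U \<in> \<U>" "G (b0, x) \<in> U"
        proof -
          have "G (b0, x) \<in> \<Union>\<U>"
            using V(4) \<open>G (b0, x) \<in> topspace X\<close> \<open>q (G (b0, x)) \<in> V\<close> by simp
          then show ?thesis using that by blast
        qed
        obtain s where s: "continuous_map (subtopology Y V) (subtopology X U) s"
            "\<And>x. x \<in> U \<Longrightarrow> s (q x) = x" "\<And>v. v \<in> V \<Longrightarrow> q (s v) = v"
          using \<U>(3)[OF U(1)] by metis
        define N2 where "N2 = N1 \<inter> {b \<in> N. G (b, x) \<in> U}"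
        have "openin (subtopology B N) {b \<in> topspace (subtopology B N). G (b, x) \<in> U}"
          using Gx \<U>(1)[OF U(1)] by (rule openin_continuous_map_preimage)
        then have "openin B {b \<in> N. G (b, x) \<in> U}"
          unfolding NB using N(1) openin_trans_full by blast
        then have N2: "openin B N2" "b0 \<in> N2"
          using N1 N U by (auto simp: N2_def)
        have N2B: "N2 \<subseteq> topspace B" using openin_subset[OF N2(1)] .
        let ?Z = "subtopology ?W (N2 \<times> {0..y})"
        have snd: "continuous_map ?Z euclideanreal snd"
        proof -
          have "continuous_map ?W unit_interval snd" by (rule continuous_map_snd)
          then show ?thesis by (auto simp: continuous_map_in_subtopology intro: continuous_map_from_subtopology)
        qed
        have "continuous_map ?Z X (\<lambda>z. if snd z \<le> x then G z else s (F z))"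
        proof (rule continuous_map_cases_le[OF snd])
          show "continuous_map (subtopology ?Z {z \<in> topspace ?Z. snd z \<le> x}) X G"
            unfolding subtopology_subtopology
            by (rule continuous_map_from_subtopology_mono[OF G(1)]) (auto simp: N2_def)
          have "continuous_map (subtopology ?Z {z \<in> topspace ?Z. x \<le> snd z}) (subtopology Y V) F"
            unfolding subtopology_subtopology continuous_map_in_subtopology
          proof
            show "continuous_map (subtopology ?W (N2 \<times> {0..y} \<inter> {z \<in> topspace ?Z. x \<le> snd z})) Y F"
              using F by (rule continuous_map_from_subtopology)
            show "F \<in> topspace (subtopology ?W (N2 \<times> {0..y} \<inter> {z \<in> topspace ?Z. x \<le> snd z})) \<rightarrow> V"
              using mid[OF x y] FV by (auto simp: N2_def subset_iff)
          qed
          from continuous_map_compose[OF this s(1)]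
          show "continuous_map (subtopology ?Z {z \<in> topspace ?Z. x \<le> snd z}) X (\<lambda>z. s (F z))"
            by (simp add: o_def continuous_map_in_subtopology)
          show "G z = s (F z)" if "z \<in> topspace ?Z" "snd z = x" for z
          proof -
            have z: "z = (fst z, x)" "fst z \<in> N2" using that by (auto simp: prod_eq_iff)
            then have "q (G z) = F z" using G(2)[of "fst z" x] x01 by (metis (no_types, lifting) IntD2 N2_def atLeastAtMost_iff mem_Collect_eq order_refl)
            moreover have "G z \<in> U" using z by (metis (no_types, lifting) IntD2 N2_def mem_Collect_eq)
            ultimately show ?thesis using s(2) by metis
          qed
        qed auto
        moreover have "q (if u \<le> x then G (b, u) else s (F (b, u))) = F (b, u)" if "b \<in> N2" "u \<in> {0..y}" for b u
          using that G(2)[of b u] s(3) FV[of b u] mid[OF x y] by (auto simp: N2_def subset_iff)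
        ultimately show ?thesis
          unfolding P_def using N2 G(3) x01
          by (intro exI[of _ N2] exI[of _ "\<lambda>z. if snd z \<le> x then G z else s (F z)"]) (auto simp: N2_def)
      qed
    qed
    show "\<exists>T. openin unit_interval T \<and> t \<in> T \<and> (\<forall>x\<in>T. \<forall>y\<in>T. P x \<longrightarrow> P y)"
      using T step by blast
  qed auto
  then show ?thesis unfolding P_def .
qed

text \<open>
  The local lifts agree where they overlap, because on each \<open>{b} \<times> [0,1]\<close> they are lifts of one path
  with the same start. They can therefore be pasted, for an arbitrary parameter space \<open>B\<close>.
\<close>
lemma covering_map_homotopy_lift:
  assumes cov: "covering_map X Y q"
    and F: "continuous_map (prod_topology B unit_interval) Y F"
    and f0: "continuous_map B X f0" "\<And>b. b \<in> topspace B \<Longrightarrow> q (f0 b) = F (b, 0)"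
  obtains G where "continuous_map (prod_topology B unit_interval) X G"
    "\<And>b t. \<lbrakk>b \<in> topspace B; t \<in> {0..1}\<rbrakk> \<Longrightarrow> q (G (b, t)) = F (b, t)"
    "\<And>b. b \<in> topspace B \<Longrightarrow> G (b, 0) = f0 b"
proof -
  let ?W = "prod_topology B unit_interval"
  have "\<forall>c\<in>topspace B. \<exists>N G. openin B N \<and> c \<in> N \<and>
           continuous_map (subtopology ?W (N \<times> {0..1})) X G \<and>
           (\<forall>b\<in>N. \<forall>u\<in>{0..1}. q (G (b, u)) = F (b, u)) \<and> (\<forall>b\<in>N. G (b, 0) = f0 b)"
    using covering_map_local_homotopy_lift[OF assms] by blast
  from bchoice[OF this] obtain N where "\<forall>c\<in>topspace B. \<exists>G. openin B (N c) \<and> c \<in> N c \<and>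
           continuous_map (subtopology ?W (N c \<times> {0..1})) X G \<and>
           (\<forall>b\<in>N c. \<forall>u\<in>{0..1}. q (G (b, u)) = F (b, u)) \<and> (\<forall>b\<in>N c. G (b, 0) = f0 b)" ..
  from bchoice[OF this] obtain G where *: "\<forall>c\<in>topspace B. openin B (N c) \<and> c \<in> N c \<and>
           continuous_map (subtopology ?W (N c \<times> {0..1})) X (G c) \<and>
           (\<forall>b\<in>N c. \<forall>u\<in>{0..1}. q (G c (b, u)) = F (b, u)) \<and> (\<forall>b\<in>N c. G c (b, 0) = f0 b)" ..
  have N: "\<And>c. c \<in> topspace B \<Longrightarrow> openin B (N c)" "\<And>c. c \<in> topspace B \<Longrightarrow> c \<in> N c"
    and G: "\<And>c. c \<in> topspace B \<Longrightarrow> continuous_map (subtopology ?W (N c \<times> {0..1})) X (G c)"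
      "\<And>c b u. \<lbrakk>c \<in> topspace B; b \<in> N c; u \<in> {0..1}\<rbrakk> \<Longrightarrow> q (G c (b, u)) = F (b, u)"
      "\<And>c b. \<lbrakk>c \<in> topspace B; b \<in> N c\<rbrakk> \<Longrightarrow> G c (b, 0) = f0 b"
    using * by auto
  have NB: "N c \<subseteq> topspace B" if "c \<in> topspace B" for c
    using openin_subset[OF N(1)[OF that]] .
  have path: "continuous_map unit_interval X (\<lambda>t. G c (b, t))" if "c \<in> topspace B" "b \<in> N c" for c b
  proof -
    have "continuous_map unit_interval (subtopology ?W (N c \<times> {0..1})) (\<lambda>t. (b, t))"
      using that NB[of c] by (auto simp: continuous_map_in_subtopology continuous_map_pairedI)
    from continuous_map_compose[OF this G(1)[OF that(1)]] show ?thesis by (simp add: o_def)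
  qed
  have agree: "G c (b, t) = G c' (b, t)"
    if "c \<in> topspace B" "c' \<in> topspace B" "b \<in> N c" "b \<in> N c'" "t \<in> {0..1}" for c c' b t
    by (rule covering_map_lift_unique[OF cov _ path[OF that(1,3)] path[OF that(2,4)], of 0])
       (use that G in auto)
  define H where "H = (\<lambda>z. G (fst z) z)"
  have "continuous_map ?W X H"
  proof (rule pasting_lemma[of "topspace B" _ "\<lambda>c. N c \<times> {0..1}" _ G])
    show "openin ?W (N c \<times> {0..1})" if "c \<in> topspace B" for c
      using N(1)[OF that] by (simp add: openin_prod_Times_iff)
    show "continuous_map (subtopology ?W (N c \<times> {0..1})) X (G c)" if "c \<in> topspace B" for c
      using G(1)[OF that] .
    show "G i z = G j z"
      if "i \<in> topspace B" "j \<in> topspace B" "z \<in> topspace ?W \<inter> N i \<times> {0..1} \<inter> N j \<times> {0..1}" for i j z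
    proof -
      obtain b t where "z = (b, t)" by (cases z)
      with that agree[of i j b t] show ?thesis by simp
    qed
    show "\<exists>j. j \<in> topspace B \<and> z \<in> N j \<times> {0..1} \<and> H z = G j z" if "z \<in> topspace ?W" for z
      using that N(2) by (intro exI[of _ "fst z"]) (auto simp: H_def)
  qed
  moreover have "q (H (b, t)) = F (b, t)" if "b \<in> topspace B" "t \<in> {0..1}" for b t
    using G(2)[OF that(1) N(2)[OF that(1)] that(2)] by (simp add: H_def)
  moreover have "H (b, 0) = f0 b" if "b \<in> topspace B" for b
    using G(3)[OF that N(2)[OF that]] by (simp add: H_def)
  ultimately show thesis by (rule that)
qed


section \<open>Lifting maps into loop spaces\<close>

lemma continuous_map_loop_map:
  assumes q: "continuous_map X Y q" and f: "continuous_map B (loop_space X x) f"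
  shows "continuous_map B (loop_space Y (q x)) (\<lambda>b. loop_map q (f b))"
  unfolding loop_map_def
proof (rule continuous_map_into_loop_space_restrict)
  show "continuous_map (prod_topology B unit_interval) Y (\<lambda>(b, t). (q \<circ> f b) t)"
    using continuous_map_compose[OF continuous_map_loop_space_eval[OF f] q]
    by (simp add: o_def case_prod_unfold)
qed (use loop_space_map_at[OF f] in auto)

lemma loop_map_const_loop [simp]: "loop_map q (const_loop x) = const_loop (q x)"
  by (auto simp: loop_map_def const_loop_def fun_eq_iff)

lemma loop_map_loop_mult: "loop_map q (loop_mult l m) = loop_mult (loop_map q l) (loop_map q m)"
  by (auto simp: loop_map_def loop_mult_def fun_eq_iff)

text \<open>
  Two loops at \<open>x\<close> with the same image are lifts of one path that start at the same point.
\<close>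
lemma inj_on_loop_map_covering:
  assumes cov: "covering_map X Y q"
  shows "inj_on (loop_map q) (topspace (loop_space X x))"
proof (rule inj_onI)
  fix l m assume l: "l \<in> topspace (loop_space X x)" and m: "m \<in> topspace (loop_space X x)"
    and eq: "loop_map q l = loop_map q m"
  have "l t = m t" if t: "t \<in> {0..1}" for t
  proof (rule covering_map_lift_unique[OF cov, of unit_interval l m 0 t])
    fix u :: real assume "u \<in> topspace unit_interval"
    then show "q (l u) = q (m u)"
      using fun_cong[OF eq, of u] by (simp add: loop_map_def)
  qed (use l m t in \<open>auto simp: topspace_loop_space\<close>)
  moreover have "l \<in> extensional {0..1}" "m \<in> extensional {0..1}"
    using l m by (auto simp: topspace_loop_space)
  ultimately show "l = m" by (rule extensionalityI[rotated 2])
qed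

text \<open>
  The adjoint homotopy \<open>B \<times> [0,1] \<rightarrow> Y\<close> is lifted starting from the constant map \<open>x\<close>. What is to be
  shown is that the lifted paths close up. Their end points \<open>G (b, 1)\<close> and the constant \<open>x\<close> are two
  lifts of the constant map \<open>q x\<close> on the connected space \<open>B\<close>, and they agree at \<open>b0\<close>, where the lifted
  path is constant.
\<close>
lemma covering_lift_into_loop_space:
  assumes cov: "covering_map X Y q" and x: "x \<in> topspace X"
    and B: "connected_space B" and b0: "b0 \<in> topspace B"
    and f: "continuous_map B (loop_space Y (q x)) f" "f b0 = const_loop (q x)"
  obtains g where "continuous_map B (loop_space X x) g" "\<And>b. b \<in> topspace B \<Longrightarrow> loop_map q (g b) = f b"
proof -
  let ?F = "\<lambda>(b, t). f b t"
  have F: "continuous_map (prod_topology B unit_interval) Y ?F"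
    by (rule continuous_map_loop_space_eval[OF f(1)])
  have c: "continuous_map B X (\<lambda>_. x)" using x by simp
  have F0: "q x = ?F (b, 0)" if "b \<in> topspace B" for b
    using loop_space_map_at(1)[OF f(1) that] by simp
  obtain G where G: "continuous_map (prod_topology B unit_interval) X G"
    "\<And>b t. \<lbrakk>b \<in> topspace B; t \<in> {0..1}\<rbrakk> \<Longrightarrow> q (G (b, t)) = ?F (b, t)"
    "\<And>b. b \<in> topspace B \<Longrightarrow> G (b, 0) = x"
    by (rule covering_map_homotopy_lift[OF cov F c F0]) (assumption | (rule that; assumption))+
  have "G (b0, 1) = x"
  proof (rule covering_map_lift_unique[OF cov, of unit_interval "\<lambda>t. G (b0, t)" "\<lambda>_. x" 0 1])
    have "continuous_map unit_interval (prod_topology B unit_interval) (\<lambda>t. (b0, t))"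
      using b0 by (simp add: continuous_map_pairedI)
    from continuous_map_compose[OF this G(1)] show "continuous_map unit_interval X (\<lambda>t. G (b0, t))"
      by (simp add: o_def)
  qed (use x b0 G f(2) in \<open>auto simp: const_loop_def\<close>)
  moreover have "continuous_map B X (\<lambda>b. G (b, 1))"
  proof -
    have "continuous_map B (prod_topology B unit_interval) (\<lambda>b. (b, 1))"
      by (simp add: continuous_map_pairedI)
    from continuous_map_compose[OF this G(1)] show ?thesis by (simp add: o_def)
  qed
  ultimately have G1: "G (b, 1) = x" if "b \<in> topspace B" for b
    using covering_map_lift_unique[OF cov B _ c, of "\<lambda>b. G (b, 1)" b0 b] that b0 G(2)[of _ 1] loop_space_map_at(2)[OF f(1)]
    by simp
  show thesis
  proof
    show "continuous_map B (loop_space X x) (\<lambda>b. restrict (\<lambda>t. G (b, t)) {0..1})"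
      by (rule continuous_map_into_loop_space_restrict) (use G G1 in auto)
    show "loop_map q (\<lambda>t\<in>{0..1}. G (b, t)) = f b" if "b \<in> topspace B" for b
      using G(2)[OF that] loop_space_map_at(3)[OF f(1) that]
      by (auto simp: loop_map_def fun_eq_iff extensional_def)
  qed
qed

lemma induced_map_class:
  assumes q: "continuous_map X Y q"
    and f: "f \<in> pointed_maps A a (loop_space X x) (const_loop x)"
  shows "induced_map A a Y (q x) q (pointed_class A a (loop_space X x) (const_loop x) f) =
         pointed_class A a (loop_space Y (q x)) (const_loop (q x)) (\<lambda>b. loop_map q (f b))"
  unfolding induced_map_def
proof (rule UN_pointed_class_eq[OF f])
  fix f' assume "pointed_homotopic A a (loop_space X x) (const_loop x) f f'"
  then obtain h where
    h: "continuous_map (prod_topology unit_interval A) (loop_space X x) h"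
      "\<forall>b. h (0, b) = f b" "\<forall>b. h (1, b) = f' b" "\<forall>t\<in>{0..1}. h (t, a) = const_loop x"
    unfolding homotopic_with_def by blast
  have "pointed_homotopic A a (loop_space Y (q x)) (const_loop (q x)) (\<lambda>b. loop_map q (f b)) (\<lambda>b. loop_map q (f' b))"
    unfolding homotopic_with_def
    by (rule exI[of _ "\<lambda>z. loop_map q (h z)"]) (use h continuous_map_loop_map[OF q h(1)] in auto)
  then show "pointed_class A a (loop_space Y (q x)) (const_loop (q x)) (\<lambda>b. loop_map q (f' b)) =
        pointed_class A a (loop_space Y (q x)) (const_loop (q x)) (\<lambda>b. loop_map q (f b))"
    by (rule pointed_class_eqI[OF homotopic_with_symD])
qed

text \<open>
  Surjectivity lifts a map \<open>A \<rightarrow> \<Omega>(Y)\<close>, and injectivity lifts a homotopy, which is a map to \<open>\<Omega>(Y)\<close>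
  on the connected space \<open>[0,1] \<times> A\<close>. That the lifts have the prescribed ends and preserve base points
  follows from the injectivity of \<open>\<Omega>(q)\<close>.
\<close>
lemma covering_induces_iso:
  assumes cov: "covering_map X Y q" and x: "x \<in> topspace X"
    and A: "connected_space A" and a: "a \<in> topspace A"
  shows "group_isomorphism (maps_to_loops_group A a X x) (maps_to_loops_group A a Y (q x))
           (induced_map A a Y (q x) q)"
proof -
  let ?CX = "pointed_class A a (loop_space X x) (const_loop x)"
  let ?CY = "pointed_class A a (loop_space Y (q x)) (const_loop (q x))"
  let ?PX = "pointed_maps A a (loop_space X x) (const_loop x)"
  let ?PY = "pointed_maps A a (loop_space Y (q x)) (const_loop (q x))"
  let ?I = "induced_map A a Y (q x) q"
  have q: "continuous_map X Y q" using cov by (simp add: covering_map_def)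
  have y: "q x \<in> topspace Y" using q x continuous_map_image_subset_topspace by blast
  have qf: "(\<lambda>b. loop_map q (f b)) \<in> ?PY" if "f \<in> ?PX" for f
    using that by (auto simp: pointed_maps_def intro: continuous_map_loop_map[OF q])
  note IC = induced_map_class[OF q]
  have "?I \<in> hom (maps_to_loops_group A a X x) (maps_to_loops_group A a Y (q x))"
  proof (rule homI)
    fix c assume "c \<in> carrier (maps_to_loops_group A a X x)"
    then show "?I c \<in> carrier (maps_to_loops_group A a Y (q x))"
      by (auto simp: carrier_maps_to_loops_group IC qf)
  next
    fix c d assume "c \<in> carrier (maps_to_loops_group A a X x)" "d \<in> carrier (maps_to_loops_group A a X x)"
    then obtain f g where "f \<in> ?PX" "g \<in> ?PX" "c = ?CX f" "d = ?CX g"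
      by (auto simp: carrier_maps_to_loops_group)
    then show "?I (c \<otimes>\<^bsub>maps_to_loops_group A a X x\<^esub> d) = ?I c \<otimes>\<^bsub>maps_to_loops_group A a Y (q x)\<^esub> ?I d"
      by (simp add: maps_to_loops_group_mult IC qf pointed_maps_loop_mult loop_map_loop_mult)
  qed
  moreover have "inj_on ?I (carrier (maps_to_loops_group A a X x))"
  proof (rule inj_onI)
    fix c d assume "c \<in> carrier (maps_to_loops_group A a X x)" "d \<in> carrier (maps_to_loops_group A a X x)"
      and eq: "?I c = ?I d"
    then obtain f g where fg: "f \<in> ?PX" "g \<in> ?PX" "c = ?CX f" "d = ?CX g"
      by (auto simp: carrier_maps_to_loops_group)
    have "?CY (\<lambda>b. loop_map q (f b)) = ?CY (\<lambda>b. loop_map q (g b))"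
      using eq fg by (simp add: IC)
    then have "(\<lambda>b. loop_map q (g b)) \<in> ?CY (\<lambda>b. loop_map q (f b))"
      using pointed_class_self[OF qf[OF fg(2)]] by simp
    then obtain h where
      h: "continuous_map (prod_topology unit_interval A) (loop_space Y (q x)) h"
        "\<And>b. h (0, b) = loop_map q (f b)" "\<And>b. h (1, b) = loop_map q (g b)"
        "\<And>t. t \<in> {0..1} \<Longrightarrow> h (t, a) = const_loop (q x)"
      unfolding pointed_class_def homotopic_with_def by blast
    have conn: "connected_space (prod_topology unit_interval A)"
      using A by (simp add: connected_space_prod_topology connected_space_subtopology)
    have "(0, a) \<in> topspace (prod_topology unit_interval A)" using a by simp
    then obtain k where k: "continuous_map (prod_topology unit_interval A) (loop_space X x) k"
      "\<And>z. z \<in> topspace (prod_topology unit_interval A) \<Longrightarrow> loop_map q (k z) = h z"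
      by (rule covering_lift_into_loop_space[OF cov x conn _ h(1)]) (use h(4) in auto)
    note inj = inj_onD[OF inj_on_loop_map_covering[OF cov]]
    have kX: "k (t, b) \<in> topspace (loop_space X x)" if "t \<in> {0..1}" "b \<in> topspace A" for t b
      using continuous_map_image_subset_topspace[OF k(1)] that by auto
    have fgX: "f b \<in> topspace (loop_space X x)" "g b \<in> topspace (loop_space X x)" if "b \<in> topspace A" for b
      using that fg(1,2) continuous_map_image_subset_topspace[of A "loop_space X x" f]
        continuous_map_image_subset_topspace[of A "loop_space X x" g] by (auto simp: pointed_maps_def)
    have "pointed_homotopic A a (loop_space X x) (const_loop x) f g"
    proof (subst homotopic_with)
      show "\<exists>h. continuous_map (prod_topology unit_interval A) (loop_space X x) h \<and>
          (\<forall>b\<in>topspace A. h (0, b) = f b) \<and> (\<forall>b\<in>topspace A. h (1, b) = g b) \<and>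
          (\<forall>t\<in>{0..1}. h (t, a) = const_loop x)"
      proof (intro exI[of _ k] conjI ballI)
        show "k (0, b) = f b" if "b \<in> topspace A" for b
          by (rule inj) (use that k(2)[of "(0, b)"] h(2) kX fgX in auto)
        show "k (1, b) = g b" if "b \<in> topspace A" for b
          by (rule inj) (use that k(2)[of "(1, b)"] h(3) kX[of 1 b] fgX in auto)
        show "k (t, a) = const_loop x" if "t \<in> {0..1}" for t
          by (rule inj) (use that a k(2)[of "(t, a)"] h(4)[OF that] kX const_loop_in_loop_space[OF x] in auto)
      qed (rule k(1))
    qed (use a in auto)
    then show "c = d" unfolding fg(3,4) by (rule pointed_class_eqI)
  qed
  moreover have "carrier (maps_to_loops_group A a Y (q x)) \<subseteq> ?I ` carrier (maps_to_loops_group A a X x)"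
  proof
    fix d assume "d \<in> carrier (maps_to_loops_group A a Y (q x))"
    then obtain f where f: "f \<in> ?PY" "d = ?CY f" by (auto simp: carrier_maps_to_loops_group)
    then obtain g where g: "continuous_map A (loop_space X x) g"
        "\<And>b. b \<in> topspace A \<Longrightarrow> loop_map q (g b) = f b"
      using covering_lift_into_loop_space[OF cov x A a, of f] by (auto simp: pointed_maps_def)
    have "g a = const_loop x"
    proof (rule inj_onD[OF inj_on_loop_map_covering[OF cov, of x]])
      show "g a \<in> topspace (loop_space X x)"
        using g(1) a continuous_map_image_subset_topspace by blast
    qed (use g(2)[OF a] f const_loop_in_loop_space[OF x] in \<open>auto simp: pointed_maps_def\<close>)
    then have gP: "g \<in> ?PX" using g by (simp add: pointed_maps_def)
    have "?CY (\<lambda>b. loop_map q (g b)) = d"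
      unfolding f(2)
      by (rule pointed_class_eqI, rule homotopic_with_equal)
         (use g(2) qf[OF gP] f(1) in \<open>auto simp: pointed_maps_def\<close>)
    then have "?I (?CX g) = d" by (simp add: IC gP)
    then show "d \<in> ?I ` carrier (maps_to_loops_group A a X x)"
      using gP by (auto simp: carrier_maps_to_loops_group)
  qed
  ultimately have "?I \<in> iso (maps_to_loops_group A a X x) (maps_to_loops_group A a Y (q x))"
    by (auto simp: iso_def bij_betw_def hom_def)
  then show ?thesis
    using group_maps_to_loops_group[OF a x] group_maps_to_loops_group[OF a y]
    by (simp add: group_isomorphism_def)
qed


section \<open>Orbit maps as covering maps\<close>

lemma (in group_action) orbit_eq_iff:
  assumes "x \<in> E" "y \<in> E"
  shows "orbit G \<phi> x = orbit G \<phi> y \<longleftrightarrow> (\<exists>g\<in>carrier G. y = \<phi> g x)"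
proof
  assume "orbit G \<phi> x = orbit G \<phi> y"
  then have "y \<in> orbit G \<phi> x" using orbit_refl[OF assms(2)] by simp
  then show "\<exists>g\<in>carrier G. y = \<phi> g x" by (auto simp: orbit_def)
next
  assume "\<exists>g\<in>carrier G. y = \<phi> g x"
  then have yx: "y \<in> orbit G \<phi> x" by (auto simp: orbit_def)
  then have xy: "x \<in> orbit G \<phi> y" using orbit_sym[OF assms] by simp
  have E: "z \<in> E" if "z \<in> orbit G \<phi> w" "w \<in> E" for z w
    using that element_image by (auto simp: orbit_def)
  show "orbit G \<phi> x = orbit G \<phi> y"
  proof (intro Set.set_eqI iffI)
    fix z assume "z \<in> orbit G \<phi> x"
    then show "z \<in> orbit G \<phi> y" using orbit_trans[OF assms(2,1) _ xy] E assms by blast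
  next
    fix z assume "z \<in> orbit G \<phi> y"
    then show "z \<in> orbit G \<phi> x" using orbit_trans[OF assms(1,2) _ yx] E assms by blast
  qed
qed

lemma moved_point_separation:
  assumes X: "Hausdorff_space X" and f: "continuous_map X X f"
    and x: "x \<in> topspace X" and fx: "f x \<noteq> x"
  shows "\<exists>W. openin X W \<and> x \<in> W \<and> f ` W \<inter> W = {}"
proof -
  have "f x \<in> topspace X" using f x continuous_map_image_subset_topspace by blast
  then obtain A B where AB: "openin X A" "openin X B" "x \<in> A" "f x \<in> B" "disjnt A B"
    using X x fx unfolding Hausdorff_space_def by metis
  have "openin X (A \<inter> {z \<in> topspace X. f z \<in> B})"
    using AB f by (intro openin_Int openin_continuous_map_preimage)
  moreover have "f ` (A \<inter> {z \<in> topspace X. f z \<in> B}) \<inter> (A \<inter> {z \<in> topspace X. f z \<in> B}) = {}"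
    using AB(5) by (auto simp: disjnt_iff)
  ultimately show ?thesis using AB x by blast
qed

text \<open>
  Only finitely many translates of a suitable neighbourhood of \<open>x\<close> meet it. Each such \<open>g \<noteq> \<one>\<close> moves
  \<open>x\<close> by freeness, so in a Hausdorff space it also moves a small neighbourhood of \<open>x\<close> off itself;
  intersecting finitely many of these neighbourhoods is enough.
\<close>
lemma free_properly_discontinuous_action_wandering:
  assumes X: "Hausdorff_space X" and act: "free_properly_discontinuous_action G X \<phi>"
    and x: "x \<in> topspace X"
  obtains U where "openin X U" "x \<in> U" "\<And>g. \<lbrakk>g \<in> carrier G; g \<noteq> \<one>\<^bsub>G\<^esub>\<rbrakk> \<Longrightarrow> \<phi> g ` U \<inter> U = {}"
proof -
  obtain U0 where U0: "openin X U0" "x \<in> U0" "finite {g \<in> carrier G. \<phi> g ` U0 \<inter> U0 \<noteq> {}}"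
    using act x unfolding free_properly_discontinuous_action_def by blast
  define S where "S = {g \<in> carrier G. \<phi> g ` U0 \<inter> U0 \<noteq> {}} - {\<one>\<^bsub>G\<^esub>}"
  have "finite S" using U0(3) by (simp add: S_def)
  have "\<forall>g\<in>S. \<exists>W. openin X W \<and> x \<in> W \<and> \<phi> g ` W \<inter> W = {}"
  proof
    fix g assume g: "g \<in> S"
    then have "g \<notin> stabilizer G \<phi> x" using act x by (auto simp: S_def free_properly_discontinuous_action_def)
    then have "\<phi> g x \<noteq> x" using g by (simp add: S_def stabilizer_def)
    moreover have "continuous_map X X (\<phi> g)"
      using act g by (simp add: S_def free_properly_discontinuous_action_def homeomorphic_imp_continuous_map)
    ultimately show "\<exists>W. openin X W \<and> x \<in> W \<and> \<phi> g ` W \<inter> W = {}"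
      using moved_point_separation[OF X _ x] by blast
  qed
  from bchoice[OF this] obtain W where W: "\<forall>g\<in>S. openin X (W g) \<and> x \<in> W g \<and> \<phi> g ` W g \<inter> W g = {}" ..
  define U where "U = \<Inter>(insert U0 (W ` S))"
  have "openin X U"
    unfolding U_def using \<open>finite S\<close> U0 W by (intro openin_Inter) auto
  moreover have "x \<in> U" using U0 W by (simp add: U_def)
  moreover have "\<phi> g ` U \<inter> U = {}" if "g \<in> carrier G" "g \<noteq> \<one>\<^bsub>G\<^esub>" for g
  proof (cases "g \<in> S")
    case True
    then have "U \<subseteq> W g" by (auto simp: U_def)
    then show ?thesis using W True by blast
  next
    case False
    then have "\<phi> g ` U0 \<inter> U0 = {}" using that by (auto simp: S_def)
    moreover have "U \<subseteq> U0" by (auto simp: U_def)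
    ultimately show ?thesis by blast
  qed
  ultimately show thesis by (rule that)
qed

text \<open>
  The sheets over the image of a wandering neighbourhood \<open>U\<close> are its translates \<open>\<phi> g ` U\<close>. They are
  disjoint and embedded because \<open>\<phi> g u = \<phi> h v\<close> with \<open>u, v \<in> U\<close> forces \<open>g = h\<close>, and the orbit map is
  open because the saturation of an open set is the union of its translates.
\<close>
lemma covering_map_orbit:
  assumes X: "Hausdorff_space X" and act: "free_properly_discontinuous_action G X \<phi>"
  shows "covering_map X (orbit_space G X \<phi>) (orbit G \<phi>)"
proof -
  let ?q = "orbit G \<phi>" and ?Y = "orbit_space G X \<phi>"
  interpret group_action G "topspace X" \<phi>
    using act by (simp add: free_properly_discontinuous_action_def)
  interpret G: group G
    using group_hom group_hom.axioms(1) by auto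
  have hom: "homeomorphic_map X X (\<phi> g)" if "g \<in> carrier G" for g
    using act that by (simp add: free_properly_discontinuous_action_def)
  have in_X: "\<phi> g x \<in> topspace X" if "g \<in> carrier G" "x \<in> topspace X" for g x
    using element_image that by blast
  have qm: "quotient_map X ?Y ?q"
    unfolding orbit_space_def by (rule quotient_map_quotient_topology)
  have cont: "continuous_map X ?Y ?q" using qm by (rule quotient_imp_continuous_map)
  have trans: "openin X (\<phi> g ` W)" if "g \<in> carrier G" "openin X W" for g W
    using homeomorphic_imp_open_map[OF hom[OF that(1)]] that(2) by (simp add: open_map_def)
  have sat: "{x \<in> topspace X. ?q x \<in> ?q ` W} = (\<Union>g\<in>carrier G. \<phi> g ` W)" if "W \<subseteq> topspace X" for W
  proof (intro Set.set_eqI iffI)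
    fix x assume "x \<in> {x \<in> topspace X. ?q x \<in> ?q ` W}"
    then obtain w where "x \<in> topspace X" "w \<in> W" "?q w = ?q x" by force
    then show "x \<in> (\<Union>g\<in>carrier G. \<phi> g ` W)"
      using orbit_eq_iff[of w x] that by auto
  next
    fix x assume "x \<in> (\<Union>g\<in>carrier G. \<phi> g ` W)"
    then obtain g w where gw: "g \<in> carrier G" "w \<in> W" "x = \<phi> g w" by blast
    then have "w \<in> topspace X" "x \<in> topspace X" using that in_X by auto
    then have "?q w = ?q x" using gw by (auto simp: orbit_eq_iff)
    then have "?q x \<in> ?q ` W" using gw(2) imageI[of w W ?q] by simp
    then show "x \<in> {x \<in> topspace X. ?q x \<in> ?q ` W}" using \<open>x \<in> topspace X\<close> by simp
  qed
  have opn: "openin ?Y (?q ` W)" if "openin X W" for W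
  proof -
    have "W \<subseteq> topspace X" using openin_subset[OF that] .
    then show ?thesis
      using that trans by (auto simp: orbit_space_def openin_quotient_topology sat)
  qed
  have "\<exists>V \<U>. openin ?Y V \<and> y \<in> V \<and> pairwise disjnt \<U> \<and> \<Union>\<U> = {x \<in> topspace X. ?q x \<in> V} \<and>
        (\<forall>U\<in>\<U>. openin X U \<and> homeomorphic_map (subtopology X U) (subtopology ?Y V) ?q)"
    if "y \<in> topspace ?Y" for y
  proof -
    obtain x where x: "x \<in> topspace X" "y = ?q x"
      using \<open>y \<in> topspace ?Y\<close> by (auto simp: orbit_space_def)
    obtain U where U: "openin X U" "x \<in> U"
      and wander: "\<And>g. \<lbrakk>g \<in> carrier G; g \<noteq> \<one>\<^bsub>G\<^esub>\<rbrakk> \<Longrightarrow> \<phi> g ` U \<inter> U = {}"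
      by (rule free_properly_discontinuous_action_wandering[OF X act x(1)]) (rule that; assumption)
    have UX: "U \<subseteq> topspace X" using openin_subset[OF U(1)] .
    \<comment> \<open>otherwise \<open>h\<^sup>-\<^sup>1 g \<noteq> \<one>\<close> would carry \<open>u \<in> U\<close> to \<open>v \<in> U\<close>\<close>
    have same: "g = h" if gh: "g \<in> carrier G" "h \<in> carrier G" "u \<in> U" "v \<in> U" "\<phi> g u = \<phi> h v" for g h u v
    proof (rule ccontr)
      assume "g \<noteq> h"
      let ?k = "inv\<^bsub>G\<^esub> h \<otimes>\<^bsub>G\<^esub> g"
      have "?k \<noteq> \<one>\<^bsub>G\<^esub>" using \<open>g \<noteq> h\<close> gh by (metis G.inv_closed G.inv_equality G.inv_inv)
      moreover have "\<phi> ?k u = v"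
        using gh UX orbit_sym_aux[of h v "\<phi> h v"] by (subst composition_rule) auto
      ultimately show False using wander[of ?k] gh by auto
    qed
    let ?\<U> = "(\<lambda>g. \<phi> g ` U) ` carrier G"
    have "pairwise disjnt ?\<U>"
    proof (rule pairwiseI)
      fix A B assume "A \<in> ?\<U>" "B \<in> ?\<U>" and ne: "A \<noteq> B"
      then obtain g h where gh: "g \<in> carrier G" "h \<in> carrier G" "A = \<phi> g ` U" "B = \<phi> h ` U" by blast
      then have "g \<noteq> h" using ne by blast
      then have "\<phi> g u \<noteq> \<phi> h v" if "u \<in> U" "v \<in> U" for u v
        using same[OF gh(1,2) that] by blast
      then show "disjnt A B" unfolding gh(3,4) disjnt_iff by (metis imageE)
    qed
    moreover have "homeomorphic_map (subtopology X (\<phi> g ` U)) (subtopology ?Y (?q ` U)) ?q"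
      if g: "g \<in> carrier G" for g
    proof (rule bijective_open_imp_homeomorphic_map)
      have gUX: "\<phi> g ` U \<subseteq> topspace X" using in_X g UX by auto
      have gU: "topspace (subtopology X (\<phi> g ` U)) = \<phi> g ` U" using gUX by auto
      have qg: "?q (\<phi> g u) = ?q u" if "u \<in> U" for u
        using orbit_eq_iff[of u "\<phi> g u"] g that UX in_X by auto
      then have qgU: "?q ` \<phi> g ` U = ?q ` U" by (simp add: image_image)
      show "continuous_map (subtopology X (\<phi> g ` U)) (subtopology ?Y (?q ` U)) ?q"
        using continuous_map_from_subtopology[OF cont] qg by (auto simp: continuous_map_in_subtopology)
      have "open_map (subtopology X (\<phi> g ` U)) ?Y ?q"
        by (rule open_map_from_subtopology[OF _ trans[OF g U(1)]]) (simp add: open_map_def opn)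
      then show "open_map (subtopology X (\<phi> g ` U)) (subtopology ?Y (?q ` U)) ?q"
        by (rule open_map_into_subtopology) (use gU qg in auto)
      show "?q ` topspace (subtopology X (\<phi> g ` U)) = topspace (subtopology ?Y (?q ` U))"
        using qgU UX unfolding gU by (auto simp: orbit_space_def)
      show "inj_on ?q (topspace (subtopology X (\<phi> g ` U)))"
        unfolding gU
      proof (rule inj_onI)
        fix a b assume "a \<in> \<phi> g ` U" "b \<in> \<phi> g ` U" and eq: "?q a = ?q b"
        then obtain u v where uv: "u \<in> U" "v \<in> U" "a = \<phi> g u" "b = \<phi> g v" by blast
        obtain h where h: "h \<in> carrier G" "b = \<phi> h a"
          using eq orbit_eq_iff[of a b] uv UX in_X[OF g] by auto
        have "\<phi> (h \<otimes>\<^bsub>G\<^esub> g) u = \<phi> g v"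
          using h uv UX g by (subst composition_rule) auto
        from same[OF _ g uv(1,2) this] have "h \<otimes>\<^bsub>G\<^esub> g = g" using h g by simp
        then have "h = \<one>\<^bsub>G\<^esub>" using h g by (metis G.l_one G.one_closed G.right_cancel)
        then have "\<phi> g v = \<phi> g u" using \<open>\<phi> (h \<otimes>\<^bsub>G\<^esub> g) u = \<phi> g v\<close> g by simp
        then show "a = b" using uv by simp
      qed
    qed
    ultimately show ?thesis
      using opn[OF U(1)] U x sat[OF UX] trans[OF _ U(1)]
      by (intro exI[of _ "?q ` U"] exI[of _ ?\<U>]) auto
  qed
  then show ?thesis using cont by (simp add: covering_map_def)
qed


section \<open>Null-homotopic loops in spheres\<close>

definition vdot :: "nat \<Rightarrow> (nat \<Rightarrow> real) \<Rightarrow> (nat \<Rightarrow> real) \<Rightarrow> real" where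
  "vdot n x y = (\<Sum>i\<le>n. x i * y i)"

lemma vdot_commute: "vdot n x y = vdot n y x"
  by (simp add: vdot_def mult.commute)

lemma vdot_lincomb: "vdot n (\<lambda>i. a * x i + b * y i) z = a * vdot n x z + b * vdot n y z"
  by (simp add: vdot_def distrib_right sum.distrib sum_distrib_left mult.assoc)

lemma vdot_zero: "(\<And>i. i \<le> n \<Longrightarrow> x i = 0) \<Longrightarrow> vdot n x y = 0"
  by (simp add: vdot_def)

lemma vdot_self_pos: "\<lbrakk>j \<le> n; x j \<noteq> 0\<rbrakk> \<Longrightarrow> vdot n x x > 0"
  unfolding vdot_def by (rule sum_pos2[of _ j]) (auto simp: zero_less_mult_iff)

lemma topspace_nsphere_vdot:
  "topspace (nsphere n) = {x. vdot n x x = 1 \<and> (\<forall>i>n. x i = 0)}"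
  by (auto simp: nsphere vdot_def power2_eq_square)

lemma continuous_map_nsphere:
  "continuous_map Z (nsphere n) f \<longleftrightarrow>
     (\<forall>i. continuous_map Z euclideanreal (\<lambda>z. f z i)) \<and> f ` topspace Z \<subseteq> topspace (nsphere n)"
  unfolding topspace_nsphere_vdot
  by (auto simp: nsphere continuous_map_in_subtopology continuous_map_componentwise_UNIV
       vdot_def power2_eq_square)

definition unit_vec :: "nat \<Rightarrow> (nat \<Rightarrow> real) \<Rightarrow> nat \<Rightarrow> real" where
  "unit_vec n x = (\<lambda>i. x i / sqrt (vdot n x x))"

lemma unit_vec_in_nsphere:
  assumes "j \<le> n" "x j \<noteq> 0" "\<And>i. i > n \<Longrightarrow> x i = 0"
  shows "unit_vec n x \<in> topspace (nsphere n)"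
proof -
  have pos: "vdot n x x > 0" using vdot_self_pos assms(1,2) .
  have "vdot n (unit_vec n x) (unit_vec n x) = vdot n x x / (sqrt (vdot n x x))\<^sup>2"
    by (simp add: vdot_def unit_vec_def sum_divide_distrib power2_eq_square)
  also have "\<dots> = 1" using pos by simp
  finally show ?thesis using assms(3) by (simp add: topspace_nsphere_vdot unit_vec_def)
qed

lemma unit_vec_on_nsphere: "x \<in> topspace (nsphere n) \<Longrightarrow> unit_vec n x = x"
  by (simp add: topspace_nsphere_vdot unit_vec_def)

text \<open>
  A straight line homotopy that avoids the origin can be normalised to one in the sphere; by the
  exponential law it is a path in the loop space.
\<close>
lemma path_component_of_loop_space_nsphere:
  assumes s: "s \<in> topspace (nsphere n)"
    and v: "\<And>i. continuous_on {0..1} (\<lambda>t. v t i)" "\<And>t i. i > n \<Longrightarrow> v t i = 0" "v 0 = s" "v 1 = s"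
    and w: "\<And>i. continuous_on {0..1} (\<lambda>t. w t i)" "\<And>t i. i > n \<Longrightarrow> w t i = 0" "w 0 = s" "w 1 = s"
    and nz: "\<And>u t. \<lbrakk>u \<in> {0..1}; t \<in> {0..1}\<rbrakk> \<Longrightarrow> \<exists>i\<le>n. (1 - u) * v t i + u * w t i \<noteq> 0"
  shows "path_component_of (loop_space (nsphere n) s)
           (restrict (\<lambda>t. unit_vec n (v t)) {0..1}) (restrict (\<lambda>t. unit_vec n (w t)) {0..1})"
proof -
  let ?x = "\<lambda>u t. \<lambda>i. (1 - u) * v t i + u * w t i"
  let ?H = "\<lambda>u t. unit_vec n (?x u t)"
  have H: "?H u t \<in> topspace (nsphere n)" if "u \<in> {0..1}" "t \<in> {0..1}" for u t
    using nz[OF that] v(2) w(2) by (auto intro: unit_vec_in_nsphere)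
  have ends: "?H u 0 = s" "?H u 1 = s" for u
    using unit_vec_on_nsphere[OF s] by (auto simp: v(3,4) w(3,4) algebra_simps)
  have "continuous_map (prod_topology unit_interval unit_interval) (nsphere n) (\<lambda>(u, t). ?H u t)"
    unfolding continuous_map_nsphere
  proof (intro conjI allI)
    fix i
    have x: "continuous_on ({0..1} \<times> {0..1}) (\<lambda>z. ?x (fst z) (snd z) i)" for i
      by (intro continuous_intros continuous_on_compose2[OF v(1)[of i]] continuous_on_compose2[OF w(1)[of i]]) auto
    have "continuous_on ({0..1} \<times> {0..1}) (\<lambda>z. ?H (fst z) (snd z) i)"
      unfolding unit_vec_def
    proof (rule continuous_on_divide[OF x])
      show "continuous_on ({0..1} \<times> {0..1}) (\<lambda>z. sqrt (vdot n (?x (fst z) (snd z)) (?x (fst z) (snd z))))"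
        unfolding vdot_def by (intro continuous_on_real_sqrt continuous_on_sum continuous_on_mult x)
      show "\<forall>z\<in>{0..1} \<times> {0..1}. sqrt (vdot n (?x (fst z) (snd z)) (?x (fst z) (snd z))) \<noteq> 0"
      proof
        fix z :: "real \<times> real" assume "z \<in> {0..1} \<times> {0..1}"
        then obtain j where "j \<le> n" "?x (fst z) (snd z) j \<noteq> 0"
          using nz[of "fst z" "snd z"] by auto
        then show "sqrt (vdot n (?x (fst z) (snd z)) (?x (fst z) (snd z))) \<noteq> 0"
          using vdot_self_pos[of j n "?x (fst z) (snd z)"] by simp
      qed
    qed
    then have "continuous_map (top_of_set ({0..1} \<times> {0..1})) euclideanreal (\<lambda>z. ?H (fst z) (snd z) i)"
      by simp
    then show "continuous_map (prod_topology unit_interval unit_interval) euclideanreal (\<lambda>z. (case z of (u, t) \<Rightarrow> ?H u t) i)"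
      by (simp add: case_prod_unfold flip: subtopology_Times)
  next
    show "(\<lambda>(u, t). ?H u t) ` topspace (prod_topology unit_interval unit_interval) \<subseteq> topspace (nsphere n)"
      using H by auto
  qed
  then have "continuous_map unit_interval (loop_space (nsphere n) s) (\<lambda>u. restrict (?H u) {0..1})"
    by (rule continuous_map_into_loop_space_restrict) (simp add: ends)
  then show ?thesis
    unfolding path_component_of_def pathin_def
    by (intro exI[of _ "\<lambda>u. restrict (?H u) {0..1}"]) (auto simp: fun_eq_iff)
qed

text \<open>
  Two orthonormal vectors of three-dimensional space orthogonal to \<open>(a, b, c)\<close>. Off the third axis
  these are \<open>(-b, a, 0)\<close>, normalised, and its cross product with the unit vector along \<open>(a, b, c)\<close>.
\<close>
lemma orthonormal_pair_orthogonal_to: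
  fixes a b c :: real
  obtains p0 p1 p2 q0 q1 q2 :: real where
    "p0 * p0 + p1 * p1 + p2 * p2 = 1" "q0 * q0 + q1 * q1 + q2 * q2 = 1"
    "p0 * q0 + p1 * q1 + p2 * q2 = 0"
    "p0 * a + p1 * b + p2 * c = 0" "q0 * a + q1 * b + q2 * c = 0"
proof (cases "a = 0 \<and> b = 0")
  case True
  then show thesis by (intro that[of 1 0 0 0 1 0]) auto
next
  case False
  define m where "m = sqrt (a\<^sup>2 + b\<^sup>2)"
  define N where "N = sqrt (m\<^sup>2 + c\<^sup>2)"
  have m2: "m\<^sup>2 = a\<^sup>2 + b\<^sup>2" by (simp add: m_def)
  have m0: "m \<noteq> 0" using False by (simp add: m_def sum_power2_eq_zero_iff)
  have N2: "N\<^sup>2 = m\<^sup>2 + c\<^sup>2" by (simp add: N_def)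
  have N0: "N \<noteq> 0" using m0 by (simp add: N_def sum_power2_eq_zero_iff)
  show thesis
  proof (rule that[of "- b / m" "a / m" 0 "a * c / (m * N)" "b * c / (m * N)" "- m / N"])
    have "- b / m * (- b / m) + a / m * (a / m) + 0 * 0 = (a\<^sup>2 + b\<^sup>2) / m\<^sup>2"
      by (simp add: power2_eq_square add_divide_distrib)
    then show "- b / m * (- b / m) + a / m * (a / m) + 0 * 0 = 1"
      using m0 by (simp add: m2[symmetric])
    have "a * c / (m * N) * (a * c / (m * N)) + b * c / (m * N) * (b * c / (m * N)) + - m / N * (- m / N)
        = ((a\<^sup>2 + b\<^sup>2) * c\<^sup>2 + m\<^sup>2 * m\<^sup>2) / (m\<^sup>2 * N\<^sup>2)"
      using m0 N0 by (simp add: field_simps power2_eq_square)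
    also have "\<dots> = m\<^sup>2 * (m\<^sup>2 + c\<^sup>2) / (m\<^sup>2 * N\<^sup>2)"
      by (simp add: m2[symmetric] algebra_simps)
    also have "\<dots> = 1" using m0 N0 by (simp add: N2[symmetric])
    finally show "a * c / (m * N) * (a * c / (m * N)) + b * c / (m * N) * (b * c / (m * N)) + - m / N * (- m / N) = 1" .
    have "a * c / (m * N) * a + b * c / (m * N) * b + - m / N * c = ((a\<^sup>2 + b\<^sup>2) * c - m\<^sup>2 * c) / (m * N)"
      using m0 N0 by (simp add: field_simps power2_eq_square)
    then show "a * c / (m * N) * a + b * c / (m * N) * b + - m / N * c = 0"
      by (simp add: m2)
  qed (use m0 N0 in \<open>simp_all add: field_simps\<close>)
qed

lemma vdot_first_three:
  assumes "n \<ge> 2" "\<And>i. i > 2 \<Longrightarrow> x i = 0"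
  shows "vdot n x y = x 0 * y 0 + x 1 * y 1 + x 2 * y 2"
proof -
  have "vdot n x y = (\<Sum>i\<in>{0,1,2}. x i * y i)"
    unfolding vdot_def by (rule sum.mono_neutral_right) (use assms in auto)
  then show ?thesis by simp
qed

text \<open>
  This is where the dimension of the sphere matters: orthogonally to \<open>s\<close> there is room for a plane
  as soon as there are three coordinates.
\<close>
lemma nsphere_orthonormal_pair:
  assumes "n \<ge> 2"
  obtains e f :: "nat \<Rightarrow> real" where
    "vdot n e e = 1" "vdot n f f = 1" "vdot n e f = 0" "vdot n e s = 0" "vdot n f s = 0"
    "\<And>i. i > n \<Longrightarrow> e i = 0" "\<And>i. i > n \<Longrightarrow> f i = 0"
proof -
  obtain p0 p1 p2 q0 q1 q2 :: real where *:
    "p0 * p0 + p1 * p1 + p2 * p2 = 1" "q0 * q0 + q1 * q1 + q2 * q2 = 1"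
    "p0 * q0 + p1 * q1 + p2 * q2 = 0"
    "p0 * s 0 + p1 * s 1 + p2 * s 2 = 0" "q0 * s 0 + q1 * s 1 + q2 * s 2 = 0"
    using orthonormal_pair_orthogonal_to[of "s 0" "s 1" "s 2"] by blast
  let ?v = "\<lambda>x0 x1 x2 i::nat. if i = 0 then x0 else if i = 1 then x1 else if i = 2 then x2 else (0::real)"
  show thesis
    by (rule that[of "?v p0 p1 p2" "?v q0 q1 q2"]) (use assms * in \<open>simp_all add: vdot_first_three\<close>)
qed

text \<open>
  General position for plane curves. A polynomial curve close to \<open>g\<close> has an image of measure zero, so
  it misses some small vector \<open>c\<close>, and its translate by \<open>- c\<close> misses the origin.
\<close>
lemma small_nonvanishing_perturbation:
  fixes g :: "real \<Rightarrow> real \<times> real"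
  assumes g: "continuous_on {0..1} g"
  obtains h where "continuous_on {0..1} h" "\<And>t. t \<in> {0..1} \<Longrightarrow> norm (h t) < 1"
    "\<And>t. t \<in> {0..1} \<Longrightarrow> g t + h t \<noteq> 0"
proof -
  obtain p where p: "polynomial_function p" "\<And>t. t \<in> {0..1} \<Longrightarrow> norm (g t - p t) < 1/2"
    using Stone_Weierstrass_polynomial_function[OF compact_Icc g, of "1/2"] by auto
  have "negligible (p ` {0..1})"
    by (rule negligible_differentiable_image_lowdim)
       (use p(1) in \<open>auto intro: differentiable_on_polynomial_function\<close>)
  moreover have "\<not> negligible (ball 0 (1/2) :: (real \<times> real) set)"
    by (rule open_not_negligible) auto
  ultimately have "\<not> ball 0 (1/2) \<subseteq> p ` {0..1}"
    using negligible_subset by blast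
  then obtain c where c: "norm c < 1/2" "c \<notin> p ` {0..1}" by (auto simp: subset_iff)
  show thesis
  proof
    show "continuous_on {0..1} (\<lambda>t. p t - c - g t)"
      using p(1) by (intro continuous_on_diff g continuous_on_const continuous_on_polymonial_function)
    show "norm (p t - c - g t) < 1" if "t \<in> {0..1}" for t
    proof -
      have "norm (p t - c - g t) \<le> norm (p t - g t) + norm c"
        using norm_triangle_ineq4[of "p t - g t" c] by (simp add: algebra_simps)
      then show ?thesis using p(2)[OF that] c(1) by (simp add: norm_minus_commute)
    qed
    show "g t + (p t - c - g t) \<noteq> 0" if "t \<in> {0..1}" for t
      using c(2) that by auto
  qed
qed

text \<open>
  A loop whose values avoid the ray through \<open>- s\<close> contracts to \<open>s\<close> along straight lines, normalised.
  An arbitrary loop \<open>l\<close> is first moved to such a loop \<open>w\<close> by a displacement shorter than \<open>1\<close> in a plane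
  orthogonal to \<open>s\<close>; the line from \<open>l\<close> to \<open>w\<close> then misses the origin. The displacement makes the
  component in the plane nonzero. Since it has to vanish at the base point, it is multiplied by a
  cutoff \<open>\<beta>\<close>, which is \<open>0\<close> at \<open>s\<close> and \<open>1\<close> on the hemisphere opposite to \<open>s\<close>; being orthogonal to \<open>s\<close>,
  the displacement does not change the component along \<open>s\<close>, so it is only in that hemisphere that \<open>w\<close>
  could meet the ray.
\<close>
lemma loop_nsphere_null_homotopic:
  assumes n: "n \<ge> 2" and s: "s \<in> topspace (nsphere n)"
    and l: "l \<in> topspace (loop_space (nsphere n) s)"
  shows "path_component_of (loop_space (nsphere n) s) l (const_loop s)"
proof -
  have lc: "continuous_map unit_interval (nsphere n) l" and lx: "l \<in> extensional {0..1}" and l0: "l 0 = s" "l 1 = s"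
    using l by (auto simp: topspace_loop_space)
  have lS: "l t \<in> topspace (nsphere n)" if "t \<in> {0..1}" for t
    using continuous_map_image_subset_topspace[OF lc] that by auto
  \<comment> \<open>\<open>l\<close> is undefined off the interval; \<open>v\<close> extends it so that all its values lie on the sphere\<close>
  define v where "v = (\<lambda>t. if t \<in> {0..1} then l t else s)"
  have vS: "v t \<in> topspace (nsphere n)" for t using lS s by (auto simp: v_def)
  have vc: "continuous_on {0..1} (\<lambda>t. v t i)" for i
  proof -
    have "continuous_on {0..1} (\<lambda>t. l t i)" using lc by (simp add: continuous_map_nsphere)
    then show ?thesis by (rule continuous_on_eq) (simp add: v_def)
  qed
  have v01: "v 0 = s" "v 1 = s" using l0 by (auto simp: v_def)
  have vv: "vdot n (v t) (v t) = 1" "\<And>i. i > n \<Longrightarrow> v t i = 0" for t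
    using vS[of t] by (auto simp: topspace_nsphere_vdot)
  have ss: "vdot n s s = 1" "\<And>i. i > n \<Longrightarrow> s i = 0" using s by (auto simp: topspace_nsphere_vdot)
  obtain e f where ef: "vdot n e e = 1" "vdot n f f = 1" "vdot n e f = 0" "vdot n e s = 0" "vdot n f s = 0"
    "\<And>i. i > n \<Longrightarrow> e i = 0" "\<And>i. i > n \<Longrightarrow> f i = 0"
    using nsphere_orthonormal_pair[OF n] by metis
  have dotc: "continuous_on {0..1} (\<lambda>t. vdot n (v t) x)" for x
    unfolding vdot_def by (intro continuous_intros vc)
  obtain h where h: "continuous_on {0..1} h" "\<And>t. t \<in> {0..1} \<Longrightarrow> norm (h t) < 1"
    "\<And>t. t \<in> {0..1} \<Longrightarrow> (vdot n (v t) e, vdot n (v t) f) + h t \<noteq> 0"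
    by (rule small_nonvanishing_perturbation[OF continuous_on_Pair[OF dotc[of e] dotc[of f]]])
       (rule that; assumption)
  define \<beta> where "\<beta> = (\<lambda>t. max 0 (min 1 (1 - vdot n (v t) s)))"
  have \<beta>c: "continuous_on {0..1} \<beta>"
    unfolding \<beta>_def by (intro continuous_intros dotc)
  have \<beta>01: "0 \<le> \<beta> t" "\<beta> t \<le> 1" for t by (auto simp: \<beta>_def)
  define r where "r = (\<lambda>t i. fst (h t) * e i + snd (h t) * f i)"
  define w where "w = (\<lambda>t i. v t i + \<beta> t * r t i)"
  have wc: "continuous_on {0..1} (\<lambda>t. w t i)" for i
    unfolding w_def r_def by (intro continuous_intros vc \<beta>c h(1))
  have w01: "w 0 = s" "w 1 = s" by (auto simp: w_def v01 \<beta>_def ss)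
  have wn: "w t i = 0" if "i > n" for t i using that ef vv(2) by (simp add: w_def r_def)
  have r_dot: "vdot n (r t) s = 0" "vdot n (r t) e = fst (h t)" "vdot n (r t) f = snd (h t)"
    "vdot n (r t) (r t) = (fst (h t))\<^sup>2 + (snd (h t))\<^sup>2" for t
  proof -
    have fe: "vdot n f e = 0" by (subst vdot_commute) (rule ef(3))
    have r: "vdot n (r t) x = fst (h t) * vdot n e x + snd (h t) * vdot n f x" for x
      unfolding r_def by (rule vdot_lincomb)
    show "vdot n (r t) s = 0" and re: "vdot n (r t) e = fst (h t)" and rf: "vdot n (r t) f = snd (h t)"
      by (simp_all add: r ef fe)
    have "vdot n (r t) (r t) = fst (h t) * vdot n e (r t) + snd (h t) * vdot n f (r t)"
      by (rule r)
    then show "vdot n (r t) (r t) = (fst (h t))\<^sup>2 + (snd (h t))\<^sup>2"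
      using re rf by (simp add: vdot_commute[of n e] vdot_commute[of n f] power2_eq_square)
  qed
  have w_dot: "vdot n (w t) x = vdot n (v t) x + \<beta> t * vdot n (r t) x" for t x
    using vdot_lincomb[of n 1 "v t" "\<beta> t" "r t" x] by (simp add: w_def)
  have "path_component_of (loop_space (nsphere n) s)
           (restrict (\<lambda>t. unit_vec n (v t)) {0..1}) (restrict (\<lambda>t. unit_vec n (w t)) {0..1})"
  proof (rule path_component_of_loop_space_nsphere[OF s vc vv(2) v01 wc wn w01])
    fix u t :: real assume u: "u \<in> {0..1}" and t: "t \<in> {0..1}"
    show "\<exists>i\<le>n. (1 - u) * v t i + u * w t i \<noteq> 0"
    proof (rule ccontr)
      assume "\<not> ?thesis"
      then have v: "v t i = - (u * \<beta> t) * r t i" if "i \<le> n" for i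
        using that by (auto simp: w_def algebra_simps add_eq_0_iff2)
      have "vdot n (v t) (v t) = (u * \<beta> t)\<^sup>2 * vdot n (r t) (r t)"
        unfolding vdot_def sum_distrib_left by (rule sum.cong) (auto simp: v power2_eq_square)
      moreover have "(norm (h t))\<^sup>2 < 1\<^sup>2"
        using h(2)[OF t] by (intro power_strict_mono) auto
      then have "vdot n (r t) (r t) < 1"
        by (simp add: r_dot norm_prod_def)
      moreover have "(u * \<beta> t)\<^sup>2 \<le> 1"
        using u \<beta>01[of t] by (simp add: power_le_one mult_le_one)
      moreover have "0 \<le> vdot n (r t) (r t)" by (simp add: r_dot)
      ultimately show False
        using vv(1)[of t] mult_left_le_one_le[of "vdot n (r t) (r t)" "(u * \<beta> t)\<^sup>2"] by simp
    qed
  qed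
  moreover have "path_component_of (loop_space (nsphere n) s)
           (restrict (\<lambda>t. unit_vec n (w t)) {0..1}) (restrict (\<lambda>t. unit_vec n s) {0..1})"
  proof (rule path_component_of_loop_space_nsphere[OF s wc wn w01 _ ss(2)])
    fix u t :: real assume u: "u \<in> {0..1}" and t: "t \<in> {0..1}"
    show "\<exists>i\<le>n. (1 - u) * w t i + u * s i \<noteq> 0"
    proof (rule ccontr)
      assume "\<not> ?thesis"
      then have "vdot n (\<lambda>i. (1 - u) * w t i + u * s i) x = 0" for x
        by (intro vdot_zero) auto
      then have z: "(1 - u) * vdot n (w t) x + u * vdot n s x = 0" for x
        by (simp add: vdot_lincomb)
      have vs: "(1 - u) * vdot n (v t) s + u = 0" using z[of s] by (simp add: w_dot r_dot ss)
      then have u1: "u < 1" using u by (cases "u = 1") auto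
      have "(1 - u) * vdot n (v t) s \<le> 0" using vs u by simp
      then have "vdot n (v t) s \<le> 0" using u1 by (simp add: mult_le_0_iff)
      then have "\<beta> t = 1" by (simp add: \<beta>_def)
      moreover have "vdot n s e = 0" "vdot n s f = 0" using ef by (simp_all add: vdot_commute[of n s])
      ultimately have "vdot n (v t) e + fst (h t) = 0" "vdot n (v t) f + snd (h t) = 0"
        using z[of e] z[of f] u1 by (auto simp: w_dot r_dot)
      then show False using h(3)[OF t] by (auto simp: prod_eq_iff)
    qed
  qed auto
  moreover have "restrict (\<lambda>t. unit_vec n (v t)) {0..1} = l"
    using lx unit_vec_on_nsphere[OF lS] by (auto simp: fun_eq_iff v_def extensional_def)
  moreover have "restrict (\<lambda>t. unit_vec n s) {0..1} = const_loop s"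
    by (simp add: const_loop_def unit_vec_on_nsphere[OF s])
  ultimately show ?thesis using path_component_of_trans by metis
qed

lemma connected_space_loop_space_nsphere:
  assumes "n \<ge> 2" and s: "s \<in> topspace (nsphere n)"
  shows "connected_space (loop_space (nsphere n) s)"
proof (rule path_connected_imp_connected_space)
  show "path_connected_space (loop_space (nsphere n) s)"
    unfolding path_connected_space_iff_path_component
    using loop_nsphere_null_homotopic[OF assms] path_component_of_trans path_component_of_sym by metis
qed


section \<open>Real projective space as an orbit space\<close>

text \<open>
  The group of order two, realised so that it acts on vectors by scalar multiplication.
\<close>
definition sign_group :: "real monoid" where
  "sign_group = \<lparr>carrier = {1, -1}, mult = (*), one = 1\<rparr>"

text \<open>
  Restricted to the sphere because a group action is by extensional bijections.
\<close>
definition antipodal_action :: "nat \<Rightarrow> real \<Rightarrow> (nat \<Rightarrow> real) \<Rightarrow> nat \<Rightarrow> real" where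
  "antipodal_action n g = (\<lambda>x\<in>topspace (nsphere n). \<lambda>i. g * x i)"

lemma group_sign_group: "group sign_group"
  by (rule groupI) (auto simp: sign_group_def)

lemma antipodal_action_into:
  assumes "g \<in> {1, -1}" "x \<in> topspace (nsphere n)"
  shows "antipodal_action n g x \<in> topspace (nsphere n)"
  using assms by (auto simp: antipodal_action_def nsphere)

lemma antipodal_action_mult:
  assumes "g \<in> {1, -1}" "h \<in> {1, -1}" "x \<in> topspace (nsphere n)"
  shows "antipodal_action n g (antipodal_action n h x) = antipodal_action n (g * h) x"
  using antipodal_action_into[OF assms(2,3)] assms(3)
  by (auto simp: antipodal_action_def mult.assoc)

lemma antipodal_action_involution:
  assumes "g \<in> {1, -1}" "x \<in> topspace (nsphere n)"
  shows "antipodal_action n g (antipodal_action n g x) = x"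
proof -
  have "g * g = 1" using assms(1) by auto
  then show ?thesis using antipodal_action_mult[OF assms(1,1,2)] assms(2) by (simp add: antipodal_action_def)
qed

lemma group_action_antipodal: "group_action sign_group (topspace (nsphere n)) (antipodal_action n)"
proof -
  let ?E = "topspace (nsphere n)"
  have Bij: "antipodal_action n g \<in> Bij ?E" if "g \<in> {1, -1}" for g
  proof -
    have "bij_betw (antipodal_action n g) ?E ?E"
      by (rule bij_betw_byWitness[of _ "antipodal_action n g"])
         (use that antipodal_action_involution antipodal_action_into in auto)
    then show ?thesis by (simp add: Bij_def antipodal_action_def)
  qed
  have "antipodal_action n \<in> hom sign_group (BijGroup ?E)"
  proof (rule homI)
    fix g h assume "g \<in> carrier sign_group" "h \<in> carrier sign_group"
    then have gh: "g \<in> {1, -1}" "h \<in> {1, -1}" by (auto simp: sign_group_def)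
    have "antipodal_action n (g * h) = compose ?E (antipodal_action n g) (antipodal_action n h)"
    proof
      fix x show "antipodal_action n (g * h) x = compose ?E (antipodal_action n g) (antipodal_action n h) x"
      proof (cases "x \<in> ?E")
        case True
        then show ?thesis by (simp add: compose_eq antipodal_action_mult[OF gh True])
      next
        case False
        then show ?thesis by (simp add: compose_def antipodal_action_def)
      qed
    qed
    then show "antipodal_action n (g \<otimes>\<^bsub>sign_group\<^esub> h) =
               antipodal_action n g \<otimes>\<^bsub>BijGroup ?E\<^esub> antipodal_action n h"
      using Bij[OF gh(1)] Bij[OF gh(2)] by (simp add: BijGroup_def sign_group_def)
  qed (use Bij in \<open>auto simp: BijGroup_def sign_group_def\<close>)
  then show ?thesis
    by (intro group_action.intro group_hom.intro group_sign_group group_BijGroup)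
       (simp add: group_hom_axioms_def)
qed

lemma homeomorphic_map_antipodal_action:
  assumes "g \<in> {1, -1}"
  shows "homeomorphic_map (nsphere n) (nsphere n) (antipodal_action n g)"
proof -
  have "continuous_map (nsphere n) (nsphere n) (\<lambda>x i. g * x i)"
    unfolding continuous_map_nsphere
  proof (intro conjI allI)
    show "continuous_map (nsphere n) euclideanreal (\<lambda>x. g * x i)" for i
      unfolding nsphere
      by (intro continuous_map_real_mult_left continuous_map_from_subtopology
            continuous_map_product_projection) simp
    show "(\<lambda>x i. g * x i) ` topspace (nsphere n) \<subseteq> topspace (nsphere n)"
      using antipodal_action_into[OF assms] by (auto simp: antipodal_action_def)
  qed
  then have "continuous_map (nsphere n) (nsphere n) (antipodal_action n g)"
    by (rule continuous_map_eq) (simp add: antipodal_action_def)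
  then have "homeomorphic_maps (nsphere n) (nsphere n) (antipodal_action n g) (antipodal_action n g)"
    using antipodal_action_involution[OF assms] by (simp add: homeomorphic_maps_def)
  then show ?thesis by (rule homeomorphic_maps_imp_map)
qed

lemma free_properly_discontinuous_antipodal_action:
  "free_properly_discontinuous_action sign_group (nsphere n) (antipodal_action n)"
  unfolding free_properly_discontinuous_action_def
proof (intro conjI ballI group_action_antipodal)
  show "homeomorphic_map (nsphere n) (nsphere n) (antipodal_action n g)"
    if "g \<in> carrier sign_group" for g
    using that by (intro homeomorphic_map_antipodal_action) (simp add: sign_group_def)
  fix x assume x: "x \<in> topspace (nsphere n)"
  have "antipodal_action n (-1) x \<noteq> x"
  proof
    assume "antipodal_action n (-1) x = x"
    then have "(\<lambda>i. - x i) = x" using x by (simp add: antipodal_action_def)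
    from fun_cong[OF this] have "x i = 0" for i by simp
    then show False using x by (simp add: nsphere)
  qed
  moreover have "antipodal_action n 1 x = x" using x by (simp add: antipodal_action_def)
  ultimately show "stabilizer sign_group (antipodal_action n) x = {\<one>\<^bsub>sign_group\<^esub>}"
    by (auto simp: stabilizer_def sign_group_def)
  show "\<exists>U. openin (nsphere n) U \<and> x \<in> U \<and>
            finite {g \<in> carrier sign_group. antipodal_action n g ` U \<inter> U \<noteq> {}}"
    using x by (intro exI[of _ "topspace (nsphere n)"]) (simp add: sign_group_def)
qed

lemma orbit_antipodal_action:
  "x \<in> topspace (nsphere n) \<Longrightarrow> orbit sign_group (antipodal_action n) x = antipodal_class x"
proof -
  assume "x \<in> topspace (nsphere n)"
  moreover have "orbit sign_group (antipodal_action n) x = (\<lambda>g. antipodal_action n g x) ` {1, -1}"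
    by (auto simp: orbit_def sign_group_def)
  ultimately show ?thesis by (simp add: antipodal_action_def antipodal_class_def)
qed

lemma covering_map_cong:
  assumes cov: "covering_map X Y q" and eq: "\<And>x. x \<in> topspace X \<Longrightarrow> q x = q' x"
  shows "covering_map X Y q'"
proof -
  have "{x \<in> topspace X. q x \<in> V} = {x \<in> topspace X. q' x \<in> V}" for V using eq by auto
  moreover have "homeomorphic_map (subtopology X U) (subtopology Y V) q \<longleftrightarrow>
     homeomorphic_map (subtopology X U) (subtopology Y V) q'" for U V
    using homeomorphic_map_eq[of "subtopology X U" "subtopology Y V" q q']
      homeomorphic_map_eq[of "subtopology X U" "subtopology Y V" q' q] eq by auto
  moreover have "continuous_map X Y q'"
    using cov eq by (auto simp: covering_map_def intro: continuous_map_eq)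
  ultimately show ?thesis using cov unfolding covering_map_def by simp
qed

lemma quotient_topology_cong:
  assumes "\<And>x. x \<in> topspace X \<Longrightarrow> q x = q' x"
  shows "quotient_topology X q = quotient_topology X q'"
proof -
  have "{x \<in> topspace X. q x \<in> U} = {x \<in> topspace X. q' x \<in> U}" for U using assms by auto
  moreover have "q ` topspace X = q' ` topspace X" using assms by auto
  ultimately show ?thesis by (simp add: quotient_topology_def)
qed

lemma covering_map_antipodal_class: "covering_map (nsphere n) (real_projective_space n) antipodal_class"
proof -
  have "Hausdorff_space (nsphere n)"
    unfolding nsphere_def by (intro Hausdorff_space_subtopology Hausdorff_Euclidean_space)
  then have "covering_map (nsphere n) (orbit_space sign_group (nsphere n) (antipodal_action n))
               (orbit sign_group (antipodal_action n))"
    using free_properly_discontinuous_antipodal_action by (rule covering_map_orbit)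
  moreover have "orbit_space sign_group (nsphere n) (antipodal_action n) = real_projective_space n"
    unfolding orbit_space_def real_projective_space_def
    by (rule quotient_topology_cong) (rule orbit_antipodal_action)
  ultimately show ?thesis
    using covering_map_cong orbit_antipodal_action by metis
qed


section \<open>Invariance of the exponent, and the theorem\<close>

lemma exp_p_group_isomorphism:
  assumes "group_isomorphism H K h"
  shows "exp_p p K = exp_p p H"
proof -
  interpret H: group H using assms by (simp add: group_isomorphism_def)
  interpret K: group K using assms by (simp add: group_isomorphism_def)
  have h: "h \<in> hom H K" and bij: "bij_betw h (carrier H) (carrier K)"
    using assms by (auto simp: group_isomorphism_def iso_def)
  interpret group_hom H K h
    using h by unfold_locales
  have im: "carrier K = h ` carrier H" using bij by (simp add: bij_betw_def)
  have pow: "h a [^]\<^bsub>K\<^esub> m = \<one>\<^bsub>K\<^esub> \<longleftrightarrow> a [^]\<^bsub>H\<^esub> m = \<one>\<^bsub>H\<^esub>" if "a \<in> carrier H" for a and m :: nat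
  proof -
    have "h a [^]\<^bsub>K\<^esub> m = h (a [^]\<^bsub>H\<^esub> m)" using hom_nat_pow[OF that] by simp
    moreover have "h (a [^]\<^bsub>H\<^esub> m) = \<one>\<^bsub>K\<^esub> \<longleftrightarrow> a [^]\<^bsub>H\<^esub> m = \<one>\<^bsub>H\<^esub>"
      using inj_on_eq_iff[OF bij_betw_imp_inj_on[OF bij], of "a [^]\<^bsub>H\<^esub> m" "\<one>\<^bsub>H\<^esub>"] that by simp
    ultimately show ?thesis by simp
  qed
  have ord: "K.ord (h a) = H.ord a" if "a \<in> carrier H" for a
    using pow[OF that] that by (simp add: K.ord_unique H.pow_eq_id)
  have "p_torsion_elements p K = h ` p_torsion_elements p H"
    by (force simp: p_torsion_elements_def im ord)
  then have "(\<forall>b\<in>p_torsion_elements p K. b [^]\<^bsub>K\<^esub> m = \<one>\<^bsub>K\<^esub>) \<longleftrightarrow>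
             (\<forall>a\<in>p_torsion_elements p H. a [^]\<^bsub>H\<^esub> m = \<one>\<^bsub>H\<^esub>)" for m :: nat
    using pow by (auto simp: p_torsion_elements_def)
  then show ?thesis by (simp add: exp_p_def)
qed

lemma covering_map_loops_sphere_iso:
  assumes cov: "covering_map X Y q" and x: "x \<in> topspace X"
    and k: "k \<ge> 2" and s: "s \<in> topspace (nsphere k)"
  shows "group_isomorphism (loops_sphere_group k s X x) (loops_sphere_group k s Y (q x))
           (loops_sphere_induced k s Y (q x) q) \<and>
         exp_p p (loops_sphere_group k s Y (q x)) = exp_p p (loops_sphere_group k s X x)"
proof -
  have iso: "group_isomorphism (loops_sphere_group k s X x) (loops_sphere_group k s Y (q x))
           (loops_sphere_induced k s Y (q x) q)"
    unfolding loops_sphere_group_def loops_sphere_induced_def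
    by (rule covering_induces_iso[OF cov x connected_space_loop_space_nsphere[OF k s]
          const_loop_in_loop_space[OF s]])
  then show ?thesis using exp_p_group_isomorphism by blast
qed

theorem theorem3p2:
  fixes n r :: nat
  assumes "n \<ge> 1" and "r \<ge> 1" and s: "s \<in> topspace (nsphere (r + 1))"
  shows
    "(\<forall>(X :: 'a topology) (G :: ('g, 'm) monoid_scheme) \<phi> x.
        homotopy_sphere n X \<and> group G \<and> free_properly_discontinuous_action G X \<phi> \<and> x \<in> topspace X
        \<longrightarrow>
        group_isomorphism
          (loops_sphere_group (r + 1) s X x)
          (loops_sphere_group (r + 1) s (orbit_space G X \<phi>) (orbit G \<phi> x))
          (loops_sphere_induced (r + 1) s (orbit_space G X \<phi>) (orbit G \<phi> x) (orbit G \<phi>)) \<and>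
        (\<forall>p::nat. prime p \<longrightarrow>
           exp_p p (loops_sphere_group (r + 1) s (orbit_space G X \<phi>) (orbit G \<phi> x)) =
           exp_p p (loops_sphere_group (r + 1) s X x))) \<and>
     (\<forall>x \<in> topspace (nsphere n).
        group_isomorphism
          (loops_sphere_group (r + 1) s (nsphere n) x)
          (loops_sphere_group (r + 1) s (real_projective_space n) (antipodal_class x))
          (loops_sphere_induced (r + 1) s (real_projective_space n) (antipodal_class x)
             antipodal_class) \<and>
        (\<forall>p::nat. prime p \<longrightarrow>
           exp_p p (loops_sphere_group (r + 1) s (real_projective_space n) (antipodal_class x)) =
           exp_p p (loops_sphere_group (r + 1) s (nsphere n) x)))"
proof -
  have k: "r + 1 \<ge> 2" using \<open>r \<ge> 1\<close> by simp
  have cov: "covering_map X (orbit_space G X \<phi>) (orbit G \<phi>)"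
    if "homotopy_sphere n X" "free_properly_discontinuous_action G X \<phi>"
    for X :: "'a topology" and G :: "('g, 'm) monoid_scheme" and \<phi>
  proof (rule covering_map_orbit[OF _ that(2)])
    show "Hausdorff_space X"
      using that(1) by (auto simp: homotopy_sphere_def finite_dim_cw_complex_def cw_structure_def)
  qed
  show ?thesis
  proof (rule conjI)
    show "\<forall>(X :: 'a topology) (G :: ('g, 'm) monoid_scheme) \<phi> x.
        homotopy_sphere n X \<and> group G \<and> free_properly_discontinuous_action G X \<phi> \<and> x \<in> topspace X
        \<longrightarrow>
        group_isomorphism
          (loops_sphere_group (r + 1) s X x)
          (loops_sphere_group (r + 1) s (orbit_space G X \<phi>) (orbit G \<phi> x))
          (loops_sphere_induced (r + 1) s (orbit_space G X \<phi>) (orbit G \<phi> x) (orbit G \<phi>)) \<and>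
        (\<forall>p::nat. prime p \<longrightarrow>
           exp_p p (loops_sphere_group (r + 1) s (orbit_space G X \<phi>) (orbit G \<phi> x)) =
           exp_p p (loops_sphere_group (r + 1) s X x))"
      by (intro allI impI, elim conjE) (use covering_map_loops_sphere_iso[OF cov _ k s] in blast)
  qed (use covering_map_loops_sphere_iso[OF covering_map_antipodal_class _ k s] in blast)
qed

end
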